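(* If $R\subseteq\mathcal{N}\times\mathcal{N}$ is a $\Delta^1_1$ relation with countable sections (i.e. $\{y:(x,y)\in R\}$ is countable for every $x\in\mathcal{N}$), then $R=\bigcup_{i\in\omega}f_i$ where $\langle f_i:i\in\omega\rangle$ is a $\Delta^1_1$ sequence of $\Delta^1_1$ partial functions (identified with their graphs). Further, if $R$ is an equivalence relation, then each $f_i$ can be chosen to be an involution.
   Context: $\mathcal{N}=\omega^\omega$ and $\Delta^1_1$ is the lightface pointclass. A $\Delta^1_1$ sequence of $\Delta^1_1$ sets is one for which some sequence of codes for its terms is $\Delta^1_1$. An involution is a total function $f:\mathcal{N}\to\mathcal{N}$ with $f\circ f=\mathrm{id}$ (the identity is allowed, as are fixed points). *)

theory Defs
  imports "HOL-Library.Countable_Set" "HOL-Library.Nat_Bijection"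
begin

type_synonym baire = "nat \<Rightarrow> nat"

datatype tm =
    Var nat
  | Zero
  | Succ tm
  | Plus tm tm
  | Times tm tm
  | App nat tm

text \<open>There are no function quantifiers in \<open>fm\<close>: the formulas are arithmetical in the
  function variables that occur in \<open>App\<close>.\<close>

datatype fm =
    Eq tm tm
  | Neg fm
  | Conj fm fm
  | All nat fm

primrec tm_val :: "(nat \<Rightarrow> nat) \<Rightarrow> (nat \<Rightarrow> baire) \<Rightarrow> tm \<Rightarrow> nat" where
  "tm_val e F (Var v) = e v"
| "tm_val e F Zero = 0"
| "tm_val e F (Succ t) = Suc (tm_val e F t)"
| "tm_val e F (Plus s t) = tm_val e F s + tm_val e F t"
| "tm_val e F (Times s t) = tm_val e F s * tm_val e F t"
| "tm_val e F (App j t) = F j (tm_val e F t)"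

primrec sat :: "(nat \<Rightarrow> nat) \<Rightarrow> (nat \<Rightarrow> baire) \<Rightarrow> fm \<Rightarrow> bool" where
  "sat e F (Eq s t) \<longleftrightarrow> tm_val e F s = tm_val e F t"
| "sat e F (Neg \<phi>) \<longleftrightarrow> \<not> sat e F \<phi>"
| "sat e F (Conj \<phi> \<psi>) \<longleftrightarrow> sat e F \<phi> \<and> sat e F \<psi>"
| "sat e F (All v \<phi>) \<longleftrightarrow> (\<forall>a. sat (e(v := a)) F \<phi>)"

primrec tm_code :: "tm \<Rightarrow> nat" where
  "tm_code (Var v) = prod_encode (0, v)"
| "tm_code Zero = prod_encode (1, 0)"
| "tm_code (Succ t) = prod_encode (2, tm_code t)"
| "tm_code (Plus s t) = prod_encode (3, prod_encode (tm_code s, tm_code t))"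
| "tm_code (Times s t) = prod_encode (4, prod_encode (tm_code s, tm_code t))"
| "tm_code (App j t) = prod_encode (5, prod_encode (j, tm_code t))"

primrec fm_code :: "fm \<Rightarrow> nat" where
  "fm_code (Eq s t) = prod_encode (0, prod_encode (tm_code s, tm_code t))"
| "fm_code (Neg \<phi>) = prod_encode (1, fm_code \<phi>)"
| "fm_code (Conj \<phi> \<psi>) = prod_encode (2, prod_encode (fm_code \<phi>, fm_code \<psi>))"
| "fm_code (All v \<phi>) = prod_encode (3, prod_encode (v, fm_code \<phi>))"

lemma tm_code_inject: "tm_code s = tm_code t \<longleftrightarrow> s = t"
proof (induction s arbitrary: t)
qed (case_tac t; auto)+

lemma fm_code_inject: "fm_code \<phi> = fm_code \<psi> \<longleftrightarrow> \<phi> = \<psi>"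
proof (induction \<phi> arbitrary: \<psi>)
qed (case_tac \<psi>; auto simp: tm_code_inject)+

text \<open>A point of the product space \<open>\<omega>\<^sup>k \<times> \<N>\<^sup>l\<close> is a pair consisting of a list of
  \<open>k\<close> numbers and a list of \<open>l\<close> elements of Baire space.\<close>

type_synonym point = "nat list \<times> baire list"

definition pspace :: "nat \<Rightarrow> nat \<Rightarrow> point set" where
  "pspace k l = {(ns, xs). length ns = k \<and> length xs = l}"

text \<open>The set defined in \<open>\<omega>\<^sup>k \<times> \<N>\<^sup>l\<close> by the \<open>\<Sigma>\<^sup>1\<^sub>1\<close> formula \<open>\<exists>z. \<phi>\<close>.
  Function variable \<open>0\<close> of \<open>\<phi>\<close> is the quantified variable \<open>z\<close>, function variable \<open>Suc j\<close> is
  the \<open>j\<close>-th function coordinate and number variable \<open>j\<close> is the \<open>j\<close>-th number coordinate.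
  The remaining variables are read as \<open>0\<close>, respectively the constant function \<open>0\<close>;
  hence no real parameter can enter through them.\<close>

definition sigma11_set :: "nat \<Rightarrow> nat \<Rightarrow> fm \<Rightarrow> point set" where
  "sigma11_set k l \<phi> = {(ns, xs) \<in> pspace k l.
     \<exists>z. sat (\<lambda>j. if j < k then ns ! j else 0)
             (case_nat z (\<lambda>j. if j < l then xs ! j else (\<lambda>_. 0))) \<phi>}"

definition sigma11 :: "nat \<Rightarrow> nat \<Rightarrow> point set \<Rightarrow> bool" where
  "sigma11 k l A \<longleftrightarrow> (\<exists>\<phi>. A = sigma11_set k l \<phi>)"

definition delta11 :: "nat \<Rightarrow> nat \<Rightarrow> point set \<Rightarrow> bool" where
  "delta11 k l A \<longleftrightarrow> A \<subseteq> pspace k l \<and> sigma11 k l A \<and> sigma11 k l (pspace k l - A)"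

text \<open>A code of a \<open>\<Delta>\<^sup>1\<^sub>1\<close> set is a pair of Goedel numbers of \<open>\<Sigma>\<^sup>1\<^sub>1\<close> definitions, one of
  the set and one of its complement.\<close>

definition delta11_code :: "nat \<Rightarrow> nat \<Rightarrow> nat \<Rightarrow> point set \<Rightarrow> bool" where
  "delta11_code k l c A \<longleftrightarrow>
     (\<exists>\<phi> \<psi>. c = prod_encode (fm_code \<phi>, fm_code \<psi>) \<and>
        A = sigma11_set k l \<phi> \<and> pspace k l - A = sigma11_set k l \<psi>)"

lemma delta11_iff_code: "delta11 k l A \<longleftrightarrow> (\<exists>c. delta11_code k l c A)"
  by (auto simp: delta11_def sigma11_def delta11_code_def sigma11_set_def)

lemma delta11_code_unique: "delta11_code k l c A \<Longrightarrow> delta11_code k l c B \<Longrightarrow> A = B"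
  by (auto simp: delta11_code_def fm_code_inject)

text \<open>The sequence of codes is a function from \<open>\<omega>\<close> to \<open>\<omega>\<close>, and it is \<open>\<Delta>\<^sup>1\<^sub>1\<close> when its graph is
  a \<open>\<Delta>\<^sup>1\<^sub>1\<close> subset of \<open>\<omega>\<^sup>2\<close>.\<close>

definition delta11_sequence :: "nat \<Rightarrow> nat \<Rightarrow> (nat \<Rightarrow> point set) \<Rightarrow> bool" where
  "delta11_sequence k l A \<longleftrightarrow>
     (\<exists>c :: nat \<Rightarrow> nat. delta11 2 0 {([i, c i], []) | i. True} \<and>
        (\<forall>i. delta11_code k l (c i) (A i)))"

definition rel_points :: "(baire \<times> baire) set \<Rightarrow> point set" where
  "rel_points R = {([], [x, y]) | x y. (x, y) \<in> R}"

definition delta11_rel :: "(baire \<times> baire) set \<Rightarrow> bool" where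
  "delta11_rel R \<longleftrightarrow> delta11 0 2 (rel_points R)"

definition delta11_rel_sequence :: "(nat \<Rightarrow> (baire \<times> baire) set) \<Rightarrow> bool" where
  "delta11_rel_sequence R \<longleftrightarrow> delta11_sequence 0 2 (\<lambda>i. rel_points (R i))"

end

(* Idea. Skolemizing a Sigma^1_1 definition of R gives, arithmetically in x, a tree whose branches
   project onto the section of R at x. Repeatedly remove the nodes that no longer have two remaining
   extensions with incompatible projections. A surviving node would generate a perfect set of
   branches, so over a countable section every node is eventually removed. If p is the node removed
   first along a branch, the extensions of p present at the removal of p have pairwise compatible
   projections, hence p alone determines the projected point; so the section at x is covered by the
   points c_p(x) determined by the nodes p. The comparison of removal stages satisfies an arithmetical
   recursion equation which, when everything gets removed, has only one solution; quantifying over that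
   solution makes each c_p uniformly Sigma^1_1, hence, being total, Delta^1_1. For equivalence relations, the involutions are those of Feldman and
   Moore: split the graph of c_n intersected with the inverse of the graph of c_m into partial
   injections with disjoint domain and range. *)

theory Submission
  imports Defs
begin

section \<open>Arithmetical predicates\<close>

text \<open>In general the stage comparison of an arithmetical induction is only Pi^1_1 in x.
  Exhaustion improves this: when nothing survives, "some solution of the equation selects y" is a
  Sigma^1_1 condition that defines a function, and ordinals never appear. The obstacle throughout is
  uniformity: a Delta^1_1 sequence of codes has to be exhibited, so the graphs and their complements
  both need Sigma^1_1 definitions with the index as a variable. Totality supplies the complements,
  since y differs from c_p(x) iff some point other than y equals c_p(x). This is why c_p(x) receives
  default values. As it may then miss the section at x, partial functions arise only at the end, by
  intersecting with R.\<close>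

definition tm_definable :: "((nat \<Rightarrow> nat) \<Rightarrow> (nat \<Rightarrow> baire) \<Rightarrow> nat) \<Rightarrow> bool" where
  "tm_definable t \<longleftrightarrow> (\<exists>\<tau>. \<forall>e F. tm_val e F \<tau> = t e F)"

text \<open>A bound number variable is the variable \<open>0\<close> of a shifted environment; here it is the argument of
  the function.\<close>

definition fun_definable :: "((nat \<Rightarrow> nat) \<Rightarrow> (nat \<Rightarrow> baire) \<Rightarrow> baire) \<Rightarrow> bool" where
  "fun_definable f \<longleftrightarrow> tm_definable (\<lambda>e F. f (\<lambda>i. e (Suc i)) F (e 0))"

definition arithmetical :: "((nat \<Rightarrow> nat) \<Rightarrow> (nat \<Rightarrow> baire) \<Rightarrow> bool) \<Rightarrow> bool" where
  "arithmetical P \<longleftrightarrow> (\<exists>\<phi>. \<forall>e F. sat e F \<phi> = P e F)"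

named_theorems definable_intros

lemma tm_definable_var [definable_intros]: "tm_definable (\<lambda>e F. e i)"
  unfolding tm_definable_def by (rule exI[of _ "Var i"]) simp

lemma tm_definable_const [definable_intros]: "tm_definable (\<lambda>e F. c)"
proof (induction c)
  case 0
  show ?case unfolding tm_definable_def by (rule exI[of _ Zero]) simp
next
  case (Suc c)
  then obtain \<tau> where "\<forall>e F. tm_val e F \<tau> = c" unfolding tm_definable_def by blast
  then show ?case unfolding tm_definable_def by (intro exI[of _ "Succ \<tau>"]) simp
qed

lemma tm_definable_Suc [definable_intros]: "tm_definable t \<Longrightarrow> tm_definable (\<lambda>e F. Suc (t e F))"
  unfolding tm_definable_def by (metis tm_val.simps(3))

lemma tm_definable_plus [definable_intros]: "tm_definable s \<Longrightarrow> tm_definable t \<Longrightarrow> tm_definable (\<lambda>e F. s e F + t e F)"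
  unfolding tm_definable_def by (metis tm_val.simps(4))

lemma tm_definable_times [definable_intros]: "tm_definable s \<Longrightarrow> tm_definable t \<Longrightarrow> tm_definable (\<lambda>e F. s e F * t e F)"
  unfolding tm_definable_def by (metis tm_val.simps(5))

lemma tm_definable_app [definable_intros]: "tm_definable t \<Longrightarrow> tm_definable (\<lambda>e F. F j (t e F))"
  unfolding tm_definable_def by (metis tm_val.simps(6))

primrec tsubst :: "(nat \<Rightarrow> tm) \<Rightarrow> tm \<Rightarrow> tm" where
  "tsubst \<sigma> (Var v) = \<sigma> v"
| "tsubst \<sigma> Zero = Zero"
| "tsubst \<sigma> (Succ t) = Succ (tsubst \<sigma> t)"
| "tsubst \<sigma> (Plus s t) = Plus (tsubst \<sigma> s) (tsubst \<sigma> t)"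
| "tsubst \<sigma> (Times s t) = Times (tsubst \<sigma> s) (tsubst \<sigma> t)"
| "tsubst \<sigma> (App j t) = App j (tsubst \<sigma> t)"

lemma tm_val_tsubst: "tm_val e F (tsubst \<sigma> \<tau>) = tm_val (\<lambda>v. tm_val e F (\<sigma> v)) F \<tau>"
  by (induction \<tau>) auto

lemma tm_definable_num_subst:
  assumes "tm_definable t" and "\<And>v. tm_definable (\<lambda>e F. \<eta> e F v)"
  shows "tm_definable (\<lambda>e F. t (\<eta> e F) F)"
proof -
  obtain \<tau> where \<tau>: "\<And>e F. tm_val e F \<tau> = t e F" using assms(1) unfolding tm_definable_def by blast
  obtain \<sigma> where "\<And>v e F. tm_val e F (\<sigma> v) = \<eta> e F v"
    using assms(2) unfolding tm_definable_def by metis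
  then have "tm_val e F (tsubst \<sigma> \<tau>) = t (\<eta> e F) F" for e F
    by (simp add: tm_val_tsubst \<tau>)
  then show ?thesis unfolding tm_definable_def by blast
qed

lemma fun_definable_app:
  assumes "fun_definable f" and "tm_definable t"
  shows "tm_definable (\<lambda>e F. f e F (t e F))"
proof -
  have "tm_definable (\<lambda>e F. case_nat (t e F) e v)" for v
    by (cases v) (simp_all add: assms tm_definable_var)
  from tm_definable_num_subst[OF assms(1)[unfolded fun_definable_def], where \<eta> = "\<lambda>e F. case_nat (t e F) e", OF this]
  show ?thesis by simp
qed

lemma fun_definable_shift:
  assumes "fun_definable f"
  shows "fun_definable (\<lambda>e. f (\<lambda>i. e (Suc i)))"
proof -
  have "tm_definable (\<lambda>e F. case_nat (e 0) (\<lambda>i. e (Suc (Suc i))) v)" for v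
    by (cases v) (simp_all add: tm_definable_var)
  from tm_definable_num_subst[OF assms[unfolded fun_definable_def],
      where \<eta> = "\<lambda>e F. case_nat (e 0) (\<lambda>i. e (Suc (Suc i)))", OF this]
  show ?thesis by (simp add: fun_definable_def)
qed

lemma tm_definable_shift: "tm_definable t \<Longrightarrow> tm_definable (\<lambda>e. t (\<lambda>i. e (Suc i)))"
  by (erule tm_definable_num_subst) (rule definable_intros)

lemma fun_definable_abs [definable_intros]: "tm_definable (\<lambda>e F. f (\<lambda>i. e (Suc i)) F (e 0)) \<Longrightarrow> fun_definable (\<lambda>e F k. f e F k)"
  unfolding fun_definable_def .

lemma arithmetical_eq [definable_intros]: "tm_definable s \<Longrightarrow> tm_definable t \<Longrightarrow> arithmetical (\<lambda>e F. s e F = t e F)"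
  unfolding tm_definable_def arithmetical_def
proof (elim exE)
  fix \<sigma> \<tau>
  assume "\<forall>e F. tm_val e F \<sigma> = s e F" "\<forall>e F. tm_val e F \<tau> = t e F"
  then show "\<exists>\<phi>. \<forall>e F. sat e F \<phi> = (s e F = t e F)"
    by (intro exI[of _ "Eq \<sigma> \<tau>"]) simp
qed

lemma arithmetical_not [definable_intros]: "arithmetical P \<Longrightarrow> arithmetical (\<lambda>e F. \<not> P e F)"
  unfolding arithmetical_def
proof (elim exE)
  fix \<phi>
  assume "\<forall>e F. sat e F \<phi> = P e F"
  then show "\<exists>\<phi>. \<forall>e F. sat e F \<phi> = (\<not> P e F)"
    by (intro exI[of _ "Neg \<phi>"]) simp
qed

lemma arithmetical_conj [definable_intros]: "arithmetical P \<Longrightarrow> arithmetical Q \<Longrightarrow> arithmetical (\<lambda>e F. P e F \<and> Q e F)"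
  unfolding arithmetical_def
proof (elim exE)
  fix \<phi> \<psi>
  assume "\<forall>e F. sat e F \<phi> = P e F" "\<forall>e F. sat e F \<psi> = Q e F"
  then show "\<exists>\<phi>. \<forall>e F. sat e F \<phi> = (P e F \<and> Q e F)"
    by (intro exI[of _ "Conj \<phi> \<psi>"]) simp
qed

lemma arithmetical_disj [definable_intros]:
  assumes "arithmetical P" and "arithmetical Q"
  shows "arithmetical (\<lambda>e F. P e F \<or> Q e F)"
proof -
  have "arithmetical (\<lambda>e F. \<not> (\<not> P e F \<and> \<not> Q e F))"
    by (intro arithmetical_not arithmetical_conj assms)
  then show ?thesis by simp
qed

lemma arithmetical_imp [definable_intros]:
  assumes "arithmetical P" and "arithmetical Q"
  shows "arithmetical (\<lambda>e F. P e F \<longrightarrow> Q e F)"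
proof -
  have "arithmetical (\<lambda>e F. \<not> P e F \<or> Q e F)"
    by (intro arithmetical_not arithmetical_disj assms)
  then show ?thesis by simp
qed

lemma arithmetical_iff [definable_intros]:
  assumes "arithmetical P" and "arithmetical Q"
  shows "arithmetical (\<lambda>e F. P e F \<longleftrightarrow> Q e F)"
proof -
  have "arithmetical (\<lambda>e F. (P e F \<longrightarrow> Q e F) \<and> (Q e F \<longrightarrow> P e F))"
    by (intro arithmetical_imp arithmetical_conj assms)
  then show ?thesis unfolding iff_conv_conj_imp .
qed

section \<open>Number quantifiers\<close>

primrec tvars :: "tm \<Rightarrow> nat set" where
  "tvars (Var v) = {v}"
| "tvars Zero = {}"
| "tvars (Succ t) = tvars t"
| "tvars (Plus s t) = tvars s \<union> tvars t"
| "tvars (Times s t) = tvars s \<union> tvars t"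
| "tvars (App j t) = tvars t"

primrec fvars :: "fm \<Rightarrow> nat set" where
  "fvars (Eq s t) = tvars s \<union> tvars t"
| "fvars (Neg \<phi>) = fvars \<phi>"
| "fvars (Conj \<phi> \<psi>) = fvars \<phi> \<union> fvars \<psi>"
| "fvars (All v \<phi>) = insert v (fvars \<phi>)"

lemma finite_fvars: "finite (fvars \<phi>)"
proof -
  have "finite (tvars t)" for t by (induction t) auto
  then show ?thesis by (induction \<phi>) auto
qed

lemma tm_val_cong: "(\<And>v. v \<in> tvars t \<Longrightarrow> e v = e' v) \<Longrightarrow> tm_val e F t = tm_val e' F t"
  by (induction t) auto

lemma sat_cong: "(\<And>v. v \<in> fvars \<phi> \<Longrightarrow> e v = e' v) \<Longrightarrow> sat e F \<phi> = sat e' F \<phi>"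
proof (induction \<phi> arbitrary: e e')
  case (Eq s t)
  then show ?case using tm_val_cong[of s e e'] tm_val_cong[of t e e'] by simp
next
  case (Neg \<phi>)
  have "sat e F \<phi> = sat e' F \<phi>"
    by (rule Neg.IH) (simp add: Neg.prems)
  then show ?case by simp
next
  case (Conj \<phi>1 \<phi>2)
  have "sat e F \<phi>1 = sat e' F \<phi>1" "sat e F \<phi>2 = sat e' F \<phi>2"
    by (rule Conj.IH; simp add: Conj.prems)+
  then show ?case by simp
next
  case (All v \<phi>)
  have "sat (e(v := a)) F \<phi> = sat (e'(v := a)) F \<phi>" for a
    by (rule All.IH) (simp add: All.prems)
  then show ?case by simp
qed

primrec frename :: "(nat \<Rightarrow> nat) \<Rightarrow> fm \<Rightarrow> fm" where
  "frename \<sigma> (Eq s t) = Eq (tsubst (Var \<circ> \<sigma>) s) (tsubst (Var \<circ> \<sigma>) t)"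
| "frename \<sigma> (Neg \<phi>) = Neg (frename \<sigma> \<phi>)"
| "frename \<sigma> (Conj \<phi> \<psi>) = Conj (frename \<sigma> \<phi>) (frename \<sigma> \<psi>)"
| "frename \<sigma> (All v \<phi>) = All (\<sigma> v) (frename \<sigma> \<phi>)"

text \<open>Bound variables are renamed along with the free ones, so injectivity excludes capture.\<close>

lemma sat_frename:
  assumes "inj \<sigma>"
  shows "sat e F (frename \<sigma> \<phi>) = sat (e \<circ> \<sigma>) F \<phi>"
proof (induction \<phi> arbitrary: e)
  case (All v \<phi>)
  have "e(\<sigma> v := a) \<circ> \<sigma> = (e \<circ> \<sigma>)(v := a)" for a
    using assms by (auto simp: fun_eq_iff inj_eq)
  then show ?case by (simp only: frename.simps sat.simps All.IH)
qed (auto simp: tm_val_tsubst comp_def)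

lemma arithmetical_all [definable_intros]:
  assumes "arithmetical (\<lambda>e F. P (e 0) (\<lambda>i. e (Suc i)) F)"
  shows "arithmetical (\<lambda>e F. \<forall>a. P a e F)"
proof -
  obtain \<phi> where \<phi>: "\<And>e F. sat e F \<phi> = P (e 0) (\<lambda>i. e (Suc i)) F"
    using assms unfolding arithmetical_def by blast
  obtain N where N: "\<And>v. v \<in> fvars \<phi> \<Longrightarrow> v \<le> N"
    using finite_fvars[of \<phi>] unfolding finite_nat_set_iff_bounded_le by blast
  \<comment> \<open>A cyclic permutation of \<open>0..N\<close>: the quantified variable 0 moves to
    \<open>N\<close> and the others move down by one. Position \<open>N\<close> is free because
    \<open>Suc N\<close> does not occur in \<open>\<phi>\<close>, and a permutation is injective, as
    renaming requires.\<close>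
  define \<sigma> where "\<sigma> v = (if v = 0 then N else if v \<le> N then v - 1 else v)" for v
  have inj: "inj \<sigma>" by (auto simp: inj_on_def \<sigma>_def split: if_splits)
  have "sat e F (All N (frename \<sigma> \<phi>)) = (\<forall>a. P a e F)" for e F
  proof -
    have "sat (e(N := a) \<circ> \<sigma>) F \<phi> = sat (case_nat a e) F \<phi>" for a
      by (rule sat_cong) (auto simp: \<sigma>_def dest!: N split: nat.splits)
    then show ?thesis by (simp add: sat_frename[OF inj] \<phi>)
  qed
  then show ?thesis unfolding arithmetical_def by blast
qed

lemma arithmetical_ex [definable_intros]:
  assumes "arithmetical (\<lambda>e F. P (e 0) (\<lambda>i. e (Suc i)) F)"
  shows "arithmetical (\<lambda>e F. \<exists>a. P a e F)"
proof -
  have "arithmetical (\<lambda>e F. \<not> (\<forall>a. \<not> P a e F))"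
    by (intro arithmetical_not arithmetical_all assms)
  then show ?thesis by simp
qed

lemma arithmetical_const [definable_intros]: "arithmetical (\<lambda>e F. b)"
proof (cases b)
  case True
  then show ?thesis using arithmetical_eq[OF tm_definable_const[of 0] tm_definable_const[of 0]] by simp
next
  case False
  then show ?thesis using
      arithmetical_not[OF arithmetical_eq[OF tm_definable_const[of 0] tm_definable_const[of 0]]]
      by simp
qed

lemma arithmetical_le [definable_intros]:
  assumes "tm_definable s" and "tm_definable t"
  shows "arithmetical (\<lambda>e F. s e F \<le> t e F)"
proof -
  have "arithmetical (\<lambda>e F. \<exists>a. s e F + a = t e F)"
    by (intro definable_intros assms[THEN tm_definable_shift])
  then show ?thesis by (simp add: le_iff_add eq_commute)
qed

lemma arithmetical_less [definable_intros]:
  assumes "tm_definable s" and "tm_definable t"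
  shows "arithmetical (\<lambda>e F. s e F < t e F)"
proof -
  have "arithmetical (\<lambda>e F. \<not> t e F \<le> s e F)"
    by (intro arithmetical_not arithmetical_le assms)
  then show ?thesis by (simp add: not_le)
qed

section \<open>Substitution of definable terms and functions\<close>

lemma tm_definable_subst:
  assumes \<eta>: "\<And>v. tm_definable (\<lambda>e F. \<eta> e F v)" and \<theta>: "\<And>j. fun_definable (\<lambda>e F. \<theta> e F j)"
  shows "tm_definable (\<lambda>e F. tm_val (\<eta> e F) (\<theta> e F) \<tau>)"
proof (induction \<tau>)
  case (App j \<tau>)
  then show ?case using fun_definable_app[OF \<theta>] by simp
qed (simp_all add: \<eta> tm_definable_const tm_definable_Suc tm_definable_plus tm_definable_times)

lemma tm_definable_substitute:
  assumes "tm_definable t" and "\<And>v. tm_definable (\<lambda>e F. \<eta> e F v)" and "\<And>j. fun_definable (\<lambda>e F. \<theta> e F j)"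
  shows "tm_definable (\<lambda>e F. t (\<eta> e F) (\<theta> e F))"
proof -
  obtain \<tau> where "\<And>e F. tm_val e F \<tau> = t e F"
    using assms(1) unfolding tm_definable_def by blast
  then show ?thesis using tm_definable_subst[OF assms(2,3), where \<tau> = \<tau>] by simp
qed

text \<open>The induction generalises over the substituted data because both get shifted when a
  quantifier is passed.\<close>

lemma sat_subst:
  assumes "\<And>v. tm_definable (\<lambda>e F. \<eta> e F v)" and "\<And>j. fun_definable (\<lambda>e F. \<theta> e F j)"
  shows "arithmetical (\<lambda>e F. sat (\<eta> e F) (\<theta> e F) \<phi>)"
  using assms
proof (induction \<phi> arbitrary: \<eta> \<theta>)
  case (Eq s t)
  then show ?case by (simp add: arithmetical_eq tm_definable_subst)
next
  case (All v \<phi>)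
  have "arithmetical (\<lambda>e F. sat ((\<eta> (\<lambda>i. e (Suc i)) F)(v := e 0)) (\<theta> (\<lambda>i. e (Suc i)) F) \<phi>)"
  proof (rule All.IH)
    fix w
    show "tm_definable (\<lambda>e F. ((\<eta> (\<lambda>i. e (Suc i)) F)(v := e 0)) w)"
      by (cases "w = v") (simp_all add: tm_definable_var tm_definable_shift[OF All.prems(1)])
  qed (rule fun_definable_shift[OF All.prems(2)])
  then show ?case unfolding sat.simps by (rule arithmetical_all)
next
  case (Neg \<phi>)
  show ?case unfolding sat.simps by (intro arithmetical_not Neg.IH Neg.prems)
next
  case (Conj \<phi>1 \<phi>2)
  show ?case unfolding sat.simps by (intro arithmetical_conj Conj.IH Conj.prems)
qed

lemma arithmetical_subst:
  assumes "arithmetical P"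
    and "\<And>v. tm_definable (\<lambda>e F. \<eta> e F v)" and "\<And>j. fun_definable (\<lambda>e F. \<theta> e F j)"
  shows "arithmetical (\<lambda>e F. P (\<eta> e F) (\<theta> e F))"
proof -
  obtain \<phi> where "\<And>e F. sat e F \<phi> = P e F"
    using assms(1) unfolding arithmetical_def by blast
  then show ?thesis using sat_subst[OF assms(2,3), where \<phi> = \<phi>] by simp
qed

lemma tm_definable_case_env [definable_intros]:
  assumes "tm_definable t" and "\<And>i. tm_definable (\<lambda>e F. f e F i)"
  shows "tm_definable (\<lambda>e F. case_nat (t e F) (f e F) v)"
  using assms by (cases v) simp_all

lemma tm_definable_case_fun [definable_intros]:
  assumes "tm_definable (\<lambda>e F. f e F (t e F))" and "\<And>i. tm_definable (\<lambda>e F. g e F i (t e F))"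
  shows "tm_definable (\<lambda>e F. case_nat (f e F) (g e F) j (t e F))"
  using assms by (cases j) simp_all

lemma tm_definable_fun_upd [definable_intros]:
  assumes "tm_definable t" and "tm_definable (\<lambda>e F. f e F w)"
  shows "tm_definable (\<lambda>e F. ((f e F)(v := t e F)) w)"
  using assms by (cases "w = v") simp_all

section \<open>\<open>\<Sigma>\<^sup>1\<^sub>1\<close> predicates and their tree form\<close>

text \<open>In contrast to \<open>prod_encode\<close> this pairing is a term of the language. It is not surjective.\<close>

definition pr :: "nat \<Rightarrow> nat \<Rightarrow> nat" where
  "pr b k = (b + k) * (b + k) + b"

lemma tm_definable_pr [definable_intros]: "tm_definable s \<Longrightarrow> tm_definable t \<Longrightarrow> tm_definable (\<lambda>e F. pr (s e F) (t e F))"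
  unfolding pr_def by (intro definable_intros)

text \<open>\<open>pr b k\<close> lies between the square of \<open>b + k\<close> and the next
  square, so the sum of the components can be read off first.\<close>

lemma pr_sum_less: "b + k < c + l \<Longrightarrow> pr b k < pr c l"
proof -
  assume "b + k < c + l"
  then have "Suc (b + k) * Suc (b + k) \<le> (c + l) * (c + l)"
    by (intro mult_le_mono) auto
  then show ?thesis by (simp add: pr_def)
qed

lemma pr_inject [simp]: "pr b k = pr c l \<longleftrightarrow> b = c \<and> k = l"
proof
  assume eq: "pr b k = pr c l"
  then have "b + k = c + l"
    using pr_sum_less[of b k c l] pr_sum_less[of c l b k] by (metis nat_neq_iff)
  then show "b = c \<and> k = l" using eq by (simp add: pr_def)
qed simp

lemma pr_less: "k < l \<Longrightarrow> pr b k < pr b l"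
  by (rule pr_sum_less) simp

text \<open>Together with \<open>pr_less\<close> this bounds by \<open>pr b m\<close> every position
  consulted by a test of level \<open>m\<close> on row \<open>b\<close>, which keeps the tests on
  rows local.\<close>

lemma le_pr: "k \<le> pr b k"
proof -
  have "k \<le> k * k" by (cases k) auto
  also have "\<dots> \<le> (b + k) * (b + k)" by (intro mult_le_mono) auto
  finally show ?thesis by (simp add: pr_def)
qed

text \<open>Injectivity of \<open>pr\<close> suffices to merge countably many functions into one;
  values off its range are arbitrary.\<close>

lemma combine:
  obtains u :: baire where "\<And>b k. u (pr b k) = g b k"
proof
  fix b k
  show "(\<lambda>m. let p = (THE p. pr (fst p) (snd p) = m) in g (fst p) (snd p)) (pr b k) = g b k"
  proof -
    have "(THE p. pr (fst p) (snd p) = pr b k) = (b, k)"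
      by (rule the_equality) auto
    then show ?thesis by simp
  qed
qed

section \<open>Closure properties of Sigma^1_1 predicates\<close>

definition sigma_definable :: "((nat \<Rightarrow> nat) \<Rightarrow> (nat \<Rightarrow> baire) \<Rightarrow> bool) \<Rightarrow> bool" where
  "sigma_definable P \<longleftrightarrow> (\<exists>Q. arithmetical Q \<and> (\<forall>e F. P e F \<longleftrightarrow> (\<exists>z. Q e (case_nat z F))))"

lemma sigma_definable_cong: "sigma_definable P \<Longrightarrow> (\<And>e F. P e F \<longleftrightarrow> Q e F) \<Longrightarrow> sigma_definable Q"
  by (simp add: sigma_definable_def)

lemma sigma_definable_arith:
  assumes "arithmetical P"
  shows "sigma_definable P"
proof -
  have "arithmetical (\<lambda>e F. P e (\<lambda>j. F (Suc j)))"
    by (rule arithmetical_subst[OF assms]) (intro definable_intros)+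
  then show ?thesis unfolding sigma_definable_def by (intro exI conjI) auto
qed

text \<open>Two function quantifiers contract to one whose rows 0 and 1 carry both
  witnesses.\<close>

lemma sigma_definable_ex_fun:
  assumes "sigma_definable (\<lambda>e F. P (F 0) e (\<lambda>j. F (Suc j)))"
  shows "sigma_definable (\<lambda>e F. \<exists>y. P y e F)"
proof -
  obtain Q where Q: "arithmetical Q"
    "\<And>e F. P (F 0) e (\<lambda>j. F (Suc j)) \<longleftrightarrow> (\<exists>z. Q e (case_nat z F))"
    using assms unfolding sigma_definable_def by blast
  let ?Q = "\<lambda>e F. Q e (case_nat (\<lambda>k. F 0 (pr 0 k)) (case_nat (\<lambda>k. F 0 (pr 1 k)) (\<lambda>j. F (Suc j))))"
  have "arithmetical ?Q"
    by (rule arithmetical_subst[OF Q(1)]) (intro definable_intros)+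
  moreover have "(\<exists>y. P y e F) \<longleftrightarrow> (\<exists>z. ?Q e (case_nat z F))" for e F
  proof
    assume "\<exists>y. P y e F"
    then obtain y z where yz: "Q e (case_nat z (case_nat y F))"
      using Q(2)[of "case_nat _ F"] by auto
    obtain u :: baire where "\<And>b k. u (pr b k) = (if b = 0 then z k else y k)"
      by (rule combine[of "\<lambda>b k. if b = 0 then z k else y k"]) blast
    then show "\<exists>z. ?Q e (case_nat z F)" using yz by (intro exI[of _ u]) simp
  next
    assume "\<exists>z. ?Q e (case_nat z F)"
    then show "\<exists>y. P y e F" using Q(2)[of "case_nat _ F"] by auto
  qed
  ultimately show ?thesis unfolding sigma_definable_def by (intro exI conjI) auto
qed

lemma sigma_definable_conj:
  assumes "sigma_definable P" and "sigma_definable P'"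
  shows "sigma_definable (\<lambda>e F. P e F \<and> P' e F)"
proof -
  obtain Q where Q: "arithmetical Q" "\<And>e F. P e F \<longleftrightarrow> (\<exists>z. Q e (case_nat z F))"
    using assms(1) unfolding sigma_definable_def by blast
  obtain Q' where Q': "arithmetical Q'" "\<And>e F. P' e F \<longleftrightarrow> (\<exists>z. Q' e (case_nat z F))"
    using assms(2) unfolding sigma_definable_def by blast
  have "sigma_definable (\<lambda>e F. \<exists>z z'. Q e (case_nat z F) \<and> Q' e (case_nat z' F))"
    by (intro sigma_definable_ex_fun sigma_definable_arith arithmetical_conj
        arithmetical_subst[OF Q(1)] arithmetical_subst[OF Q'(1)] definable_intros)
  then show ?thesis by (simp add: Q Q')
qed

lemma sigma_definable_disj:
  assumes "sigma_definable P" and "sigma_definable P'"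
  shows "sigma_definable (\<lambda>e F. P e F \<or> P' e F)"
proof -
  obtain Q where Q: "arithmetical Q" "\<And>e F. P e F \<longleftrightarrow> (\<exists>z. Q e (case_nat z F))"
    using assms(1) unfolding sigma_definable_def by blast
  obtain Q' where Q': "arithmetical Q'" "\<And>e F. P' e F \<longleftrightarrow> (\<exists>z. Q' e (case_nat z F))"
    using assms(2) unfolding sigma_definable_def by blast
  have "arithmetical (\<lambda>e F. Q e F \<or> Q' e F)" by (intro definable_intros Q Q')
  then show ?thesis unfolding sigma_definable_def by (rule exI[of _ "\<lambda>e F. Q e F \<or> Q' e F", OF conjI]) (auto simp: Q Q')
qed

lemma sigma_definable_subst:
  assumes "sigma_definable P"
    and \<eta>: "\<And>v. tm_definable (\<lambda>e F. \<eta> e F v)" and \<theta>: "\<And>j. fun_definable (\<lambda>e F. \<theta> e F j)"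
  shows "sigma_definable (\<lambda>e F. P (\<eta> e F) (\<theta> e F))"
proof -
  obtain Q where Q: "arithmetical Q" "\<And>e F. P e F \<longleftrightarrow> (\<exists>z. Q e (case_nat z F))"
    using assms(1) unfolding sigma_definable_def by blast
  have *: "arithmetical (\<lambda>e F. Q (\<eta> e (\<lambda>j. F (Suc j))) (case_nat (F 0) (\<theta> e (\<lambda>j. F (Suc j)))))"
  proof -
    have \<eta>': "tm_definable (\<lambda>e F. \<eta> e (\<lambda>j. F (Suc j)) v)" for v
      by (rule tm_definable_substitute[OF \<eta>]) (intro definable_intros)+
    have "fun_definable (\<lambda>e F. \<theta> e (\<lambda>j. F (Suc j)) j)" for j
      unfolding fun_definable_def by (rule
          tm_definable_substitute[OF \<theta>[unfolded fun_definable_def]]) (intro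
          definable_intros)+
    moreover have "fun_definable (\<lambda>e F. F 0)" by (intro definable_intros)
    ultimately have "fun_definable (\<lambda>e F. case_nat (F 0) (\<theta> e (\<lambda>j. F (Suc j))) j)" for j
      by (cases j) simp_all
    with \<eta>' show ?thesis by (intro arithmetical_subst[OF Q(1)])
  qed
  show ?thesis
    unfolding Q by (intro sigma_definable_ex_fun sigma_definable_arith *)
qed

text \<open>Locality is demanded in \<open>F\<close> too, since the point \<open>y\<close> and the
  Sigma^1_1 witness are later absorbed into the branch.\<close>

definition tree_local where
  "tree_local T \<longleftrightarrow> (\<forall>n (e :: nat \<Rightarrow> nat) u u' F F'. (\<forall>k<n. u k = u' k) \<longrightarrow>
     (\<forall>j. \<forall>k<n. F j k = F' j k) \<longrightarrow> T n e u F = T n e u' F')"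

lemma tree_localD:
  assumes "tree_local T" and "\<And>k. k < n \<Longrightarrow> u k = u' k" and "\<And>j k. k < n \<Longrightarrow> F j k = F' j k"
  shows "T n e u F = T n e u' F'"
  using assms unfolding tree_local_def by blast

text \<open>The branch \<open>u\<close> collects Skolem functions; locality in \<open>u\<close> and \<open>F\<close> makes the defining condition
  closed.\<close>

definition treeform where
  "treeform P \<longleftrightarrow> (\<exists>T. arithmetical (\<lambda>e F. T (e 0) (\<lambda>i. e (Suc i)) (F 0) (\<lambda>j. F (Suc j))) \<and> tree_local T \<and>
     (\<forall>e F. P e F \<longleftrightarrow> (\<exists>u. \<forall>n. T n e u F)))"

lemma arithmetical_tree:
  assumes "arithmetical (\<lambda>e F. T (e 0) (\<lambda>i. e (Suc i)) (F 0) (\<lambda>j. F (Suc j)))"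
    and "tm_definable n" and "\<And>v. tm_definable (\<lambda>e F. \<eta> e F v)" and "fun_definable u" and "\<And>j. fun_definable (\<lambda>e F. \<theta> e F j)"
  shows "arithmetical (\<lambda>e F. T (n e F) (\<eta> e F) (u e F) (\<theta> e F))"
proof -
  have "fun_definable (\<lambda>e F. case_nat (u e F) (\<theta> e F) j)" for j
    using assms by (cases j) simp_all
  moreover have "tm_definable (\<lambda>e F. case_nat (n e F) (\<eta> e F) v)" for v
    using assms by (cases v) simp_all
  ultimately show ?thesis
    using arithmetical_subst[OF assms(1), where \<eta> = "\<lambda>e F. case_nat (n e F) (\<eta> e F)"
        and \<theta> = "\<lambda>e F. case_nat (u e F) (\<theta> e F)"] by simp
qed

lemma treeformI:
  assumes "arithmetical (\<lambda>e F. T (e 0) (\<lambda>i. e (Suc i)) (F 0) (\<lambda>j. F (Suc j)))"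
    and "\<And>n e u u' F F'. (\<And>k. k < n \<Longrightarrow> u k = u' k) \<Longrightarrow> (\<And>j k. k < n \<Longrightarrow> F j k = F' j k) \<Longrightarrow>
           T n e u F = T n e u' F'"
    and "\<And>e F. P e F \<longleftrightarrow> (\<exists>u. \<forall>n. T n e u F)"
  shows "treeform P"
  unfolding treeform_def tree_local_def using assms by (intro exI[of _ T]) blast

text \<open>The use of an oracle computation: evaluating a term consults finitely many values of
  \<open>F\<close>, so an atom is decided once \<open>n\<close> exceeds all arguments
  queried.\<close>

primrec queries_below :: "nat \<Rightarrow> (nat \<Rightarrow> nat) \<Rightarrow> (nat \<Rightarrow> baire) \<Rightarrow> tm \<Rightarrow> bool" where
  "queries_below n e F (Var v) \<longleftrightarrow> True"
| "queries_below n e F Zero \<longleftrightarrow> True"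
| "queries_below n e F (Succ t) \<longleftrightarrow> queries_below n e F t"
| "queries_below n e F (Plus s t) \<longleftrightarrow> queries_below n e F s \<and> queries_below n e F t"
| "queries_below n e F (Times s t) \<longleftrightarrow> queries_below n e F s \<and> queries_below n e F t"
| "queries_below n e F (App j t) \<longleftrightarrow> queries_below n e F t \<and> tm_val e F t < n"

lemma queries_below_cong:
  assumes "\<And>j k. k < n \<Longrightarrow> F j k = F' j k" and "queries_below n e F t"
  shows "queries_below n e F' t \<and> tm_val e F' t = tm_val e F t"
  using assms by (induction t) auto

lemma queries_below_mono: "queries_below n e F t \<Longrightarrow> n \<le> m \<Longrightarrow> queries_below m e F t"
  by (induction t) auto

lemma ex_queries_below: "\<exists>n. queries_below n e F t"
proof (induction t)
  case (Plus s t)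
  then obtain n m where "queries_below n e F s" "queries_below m e F t" by blast
  then have "queries_below (max n m) e F (Plus s t)" by (auto intro: queries_below_mono)
  then show ?case ..
next
  case (Times s t)
  then obtain n m where "queries_below n e F s" "queries_below m e F t" by blast
  then have "queries_below (max n m) e F (Times s t)" by (auto intro: queries_below_mono)
  then show ?case ..
next
  case (App j t)
  then obtain n where "queries_below n e F t" by blast
  then have "queries_below (max n (Suc (tm_val e F t))) e F (App j t)"
    by (auto intro: queries_below_mono)
  then show ?case ..
qed simp_all

lemma arithmetical_queries_below:
  "arithmetical (\<lambda>e F. queries_below (e 0) (\<lambda>i. e (Suc i)) (\<lambda>j. F (Suc j)) t)"
proof (induction t)
  case (App j t)
  have "tm_definable (\<lambda>e F. tm_val (\<lambda>i. e (Suc i)) (\<lambda>j. F (Suc j)) t)"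
    by (intro tm_definable_subst definable_intros)
  then show ?case unfolding queries_below.simps by (intro definable_intros App)
qed (auto intro: definable_intros)

text \<open>The test is vacuous below the use and equals the truth value beyond it, so the branch
  carries no information. The flag \<open>b\<close> treats an equation and its negation at
  once.\<close>

lemma treeform_atom: "treeform (\<lambda>e F. (tm_val e F s = tm_val e F t) = b)"
proof (rule treeformI)
  let ?T = "\<lambda>n e (u :: baire) F. queries_below n e F s \<and> queries_below n e F t \<longrightarrow>
    (tm_val e F s = tm_val e F t) = b"
  show "arithmetical (\<lambda>e F. ?T (e 0) (\<lambda>i. e (Suc i)) (F 0) (\<lambda>j. F (Suc j)))"
    by (intro definable_intros arithmetical_queries_below tm_definable_subst)
  show "?T n e u F = ?T n e u' F'" if "\<And>j k. k < n \<Longrightarrow> F j k = F' j k" for n e u u' F F'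
    using queries_below_cong[of n F F' e] queries_below_cong[of n F' F e] that by metis
  show "((tm_val e F s = tm_val e F t) = b) \<longleftrightarrow> (\<exists>u. \<forall>n. ?T n e u F)" for e F
  proof -
    obtain n m where "queries_below n e F s" "queries_below m e F t"
      using ex_queries_below by metis
    then have "queries_below (max n m) e F s \<and> queries_below (max n m) e F t"
      by (auto intro: queries_below_mono)
    then show ?thesis by blast
  qed
qed

lemma treeform_conj:
  assumes "treeform P" and "treeform P'"
  shows "treeform (\<lambda>e F. P e F \<and> P' e F)"
proof -
  obtain T where T: "arithmetical (\<lambda>e F. T (e 0) (\<lambda>i. e (Suc i)) (F 0) (\<lambda>j. F (Suc j)))" "tree_local T"
    "\<And>e F. P e F \<longleftrightarrow> (\<exists>u. \<forall>n. T n e u F)"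
    using assms(1) unfolding treeform_def by blast
  obtain T' where T': "arithmetical (\<lambda>e F. T' (e 0) (\<lambda>i. e (Suc i)) (F 0) (\<lambda>j. F (Suc j)))" "tree_local T'"
    "\<And>e F. P' e F \<longleftrightarrow> (\<exists>u. \<forall>n. T' n e u F)"
    using assms(2) unfolding treeform_def by blast
  \<comment> \<open>The guard delays level \<open>m\<close> until the first \<open>m\<close> entries
    of both rows lie below \<open>n\<close>. Delaying costs nothing, since all \<open>n\<close> are
    quantified.\<close>
  let ?S = "\<lambda>n e u F. \<forall>m. pr 1 m \<le> n \<longrightarrow>
    T m e (\<lambda>k. u (pr 0 k)) F \<and> T' m e (\<lambda>k. u (pr 1 k)) F"
  show ?thesis
  proof (rule treeformI)
    show "arithmetical (\<lambda>e F. ?S (e 0) (\<lambda>i. e (Suc i)) (F 0) (\<lambda>j. F (Suc j)))"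
      by (intro definable_intros arithmetical_tree[OF T(1)] arithmetical_tree[OF T'(1)])
    show "?S n e u F = ?S n e u' F'"
      if u: "\<And>k. k < n \<Longrightarrow> u k = u' k" and F: "\<And>j k. k < n \<Longrightarrow> F j k = F' j k" for n e u u' F F'
    proof -
      have "T m e (\<lambda>k. u (pr 0 k)) F = T m e (\<lambda>k. u' (pr 0 k)) F'"
        "T' m e (\<lambda>k. u (pr 1 k)) F = T' m e (\<lambda>k. u' (pr 1 k)) F'" if m: "pr 1 m \<le> n" for m
      proof -
        have "k < n \<and> pr 0 k < n \<and> pr 1 k < n" if "k < m" for k
          using that m pr_less[OF that, of 1] le_pr[of m 1] pr_sum_less[of 0 k 1 m] by auto
        then have "\<forall>k<m. u (pr 0 k) = u' (pr 0 k)" "\<forall>k<m. u (pr 1 k) = u' (pr 1 k)"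
          "\<forall>j. \<forall>k<m. F j k = F' j k" using u F by auto
        then show "T m e (\<lambda>k. u (pr 0 k)) F = T m e (\<lambda>k. u' (pr 0 k)) F'"
          "T' m e (\<lambda>k. u (pr 1 k)) F = T' m e (\<lambda>k. u' (pr 1 k)) F'"
          by (auto intro!: tree_localD[OF T(2)] tree_localD[OF T'(2)])
      qed
      then show ?thesis by auto
    qed
    show "P e F \<and> P' e F \<longleftrightarrow> (\<exists>u. \<forall>n. ?S n e u F)" for e F
    proof
      assume "P e F \<and> P' e F"
      then obtain w w' where w: "\<And>n. T n e w F" "\<And>n. T' n e w' F" using T(3) T'(3) by blast
      obtain u :: baire where "\<And>b k. u (pr b k) = (if b = 0 then w k else w' k)"
        by (rule combine[of "\<lambda>b k. if b = 0 then w k else w' k"]) blast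
      then show "\<exists>u. \<forall>n. ?S n e u F" using w by (intro exI[of _ u]) simp
    next
      assume "\<exists>u. \<forall>n. ?S n e u F"
      then obtain u where u: "\<And>n. ?S n e u F" by blast
      have "T m e (\<lambda>k. u (pr 0 k)) F \<and> T' m e (\<lambda>k. u (pr 1 k)) F" for m
        using u[of "pr 1 m"] by simp
      then show "P e F \<and> P' e F" unfolding T(3) T'(3) by (intro conjI exI allI) auto
    qed
  qed
qed

lemma treeform_disj:
  assumes "treeform P" and "treeform P'"
  shows "treeform (\<lambda>e F. P e F \<or> P' e F)"
proof -
  obtain T where T: "arithmetical (\<lambda>e F. T (e 0) (\<lambda>i. e (Suc i)) (F 0) (\<lambda>j. F (Suc j)))" "tree_local T"
    "\<And>e F. P e F \<longleftrightarrow> (\<exists>u. \<forall>n. T n e u F)"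
    using assms(1) unfolding treeform_def by blast
  obtain T' where T': "arithmetical (\<lambda>e F. T' (e 0) (\<lambda>i. e (Suc i)) (F 0) (\<lambda>j. F (Suc j)))" "tree_local T'"
    "\<And>e F. P' e F \<longleftrightarrow> (\<exists>u. \<forall>n. T' n e u F)"
    using assms(2) unfolding treeform_def by blast
  \<comment> \<open>\<open>u 0\<close> names the disjunct and the rest of \<open>u\<close> is its
    branch; because of this shift by one, level \<open>m\<close> is tested only for
    \<open>m < n\<close>.\<close>
  let ?S = "\<lambda>n e u F. \<forall>m. m < n \<longrightarrow>
    (u 0 = 0 \<and> T m e (\<lambda>k. u (Suc k)) F) \<or> (\<not> u 0 = 0 \<and> T' m e (\<lambda>k. u (Suc k)) F)"
  show ?thesis
  proof (rule treeformI)
    show "arithmetical (\<lambda>e F. ?S (e 0) (\<lambda>i. e (Suc i)) (F 0) (\<lambda>j. F (Suc j)))"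
      by (intro definable_intros arithmetical_tree[OF T(1)] arithmetical_tree[OF T'(1)])
    show "?S n e u F = ?S n e u' F'"
      if u: "\<And>k. k < n \<Longrightarrow> u k = u' k" and F: "\<And>j k. k < n \<Longrightarrow> F j k = F' j k" for n e u u' F F'
    proof -
      have "u 0 = u' 0" "T m e (\<lambda>k. u (Suc k)) F = T m e (\<lambda>k. u' (Suc k)) F'"
        "T' m e (\<lambda>k. u (Suc k)) F = T' m e (\<lambda>k. u' (Suc k)) F'" if m: "m < n" for m
      proof -
        have "\<forall>k<m. u (Suc k) = u' (Suc k)"
          "\<forall>j. \<forall>k<m. F j k = F' j k" using u F m by auto
        then show "T m e (\<lambda>k. u (Suc k)) F = T m e (\<lambda>k. u' (Suc k)) F'"
          "T' m e (\<lambda>k. u (Suc k)) F = T' m e (\<lambda>k. u' (Suc k)) F'"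
          by (auto intro!: tree_localD[OF T(2)] tree_localD[OF T'(2)])
        show "u 0 = u' 0" using u m by simp
      qed
      then show ?thesis by auto
    qed
    show "P e F \<or> P' e F \<longleftrightarrow> (\<exists>u. \<forall>n. ?S n e u F)" for e F
    proof
      assume "P e F \<or> P' e F"
      then show "\<exists>u. \<forall>n. ?S n e u F"
      proof
        assume "P e F"
        then obtain w where "\<And>n. T n e w F" using T(3) by blast
        then show ?thesis by (intro exI[of _ "case_nat 0 w"]) simp
      next
        assume "P' e F"
        then obtain w where "\<And>n. T' n e w F" using T'(3) by blast
        then show ?thesis by (intro exI[of _ "case_nat 1 w"]) simp
      qed
    next
      assume "\<exists>u. \<forall>n. ?S n e u F"
      then obtain u where "\<And>n. ?S n e u F" by blast
      then have "(u 0 = 0 \<and> T m e (\<lambda>k. u (Suc k)) F) \<or> (\<not> u 0 = 0 \<and> T' m e (\<lambda>k. u (Suc k)) F)" for m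
        using lessI[of m] by blast
      then have "(\<forall>m. T m e (\<lambda>k. u (Suc k)) F) \<or> (\<forall>m. T' m e (\<lambda>k. u (Suc k)) F)"
        by (cases "u 0 = 0") auto
      then show "P e F \<or> P' e F" unfolding T(3) T'(3) by (auto intro: exI[of _ "\<lambda>k. u (Suc k)"])
    qed
  qed
qed

lemma treeform_all:
  assumes "treeform P"
  shows "treeform (\<lambda>e F. \<forall>b. P (e(v := b)) F)"
proof -
  obtain T where T: "arithmetical (\<lambda>e F. T (e 0) (\<lambda>i. e (Suc i)) (F 0) (\<lambda>j. F (Suc j)))" "tree_local T"
    "\<And>e F. P e F \<longleftrightarrow> (\<exists>u. \<forall>n. T n e u F)"
    using assms(1) unfolding treeform_def by blast
  \<comment> \<open>Row \<open>b\<close> of \<open>u\<close> is the branch for the instance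
    \<open>b\<close>, so \<open>u\<close> acts as a Skolem function.\<close>
  let ?S = "\<lambda>n e u F. \<forall>b m. pr b m \<le> n \<longrightarrow> T m (e(v := b)) (\<lambda>k. u (pr b k)) F"
  show ?thesis
  proof (rule treeformI)
    show "arithmetical (\<lambda>e F. ?S (e 0) (\<lambda>i. e (Suc i)) (F 0) (\<lambda>j. F (Suc j)))"
      by (intro definable_intros arithmetical_tree[OF T(1)])
    show "?S n e u F = ?S n e u' F'"
      if u: "\<And>k. k < n \<Longrightarrow> u k = u' k" and F: "\<And>j k. k < n \<Longrightarrow> F j k = F' j k" for n e u u' F F'
    proof -
      have "T m (e(v := b)) (\<lambda>k. u (pr b k)) F = T m (e(v := b)) (\<lambda>k. u' (pr b k)) F'"
        if m: "pr b m \<le> n" for m b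
      proof -
        have "k < n \<and> pr b k < n" if "k < m" for k
          using that m pr_less[OF that, of b] le_pr[of m b] by auto
        then have "\<forall>k<m. u (pr b k) = u' (pr b k)" "\<forall>j. \<forall>k<m. F j k = F' j k" using u F by auto
        then show ?thesis by (auto intro!: tree_localD[OF T(2)])
      qed
      then show ?thesis by auto
    qed
    show "(\<forall>b. P (e(v := b)) F) \<longleftrightarrow> (\<exists>u. \<forall>n. ?S n e u F)" for e F
    proof
      assume "\<forall>b. P (e(v := b)) F"
      then obtain w where w: "\<And>b n. T n (e(v := b)) (w b) F" unfolding T(3) by metis
      obtain u :: baire where "\<And>b k. u (pr b k) = w b k"
        by (rule combine[of w]) blast
      then show "\<exists>u. \<forall>n. ?S n e u F" using w by (intro exI[of _ u]) simp
    next
      assume "\<exists>u. \<forall>n. ?S n e u F"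
      then obtain u where u: "\<And>n. ?S n e u F" by blast
      have "T m (e(v := b)) (\<lambda>k. u (pr b k)) F" for b m
        using u[of "pr b m"] by simp
      then show "\<forall>b. P (e(v := b)) F" unfolding T(3) by (intro exI allI)
    qed
  qed
qed

lemma treeform_ex:
  assumes "treeform P"
  shows "treeform (\<lambda>e F. \<exists>b. P (e(v := b)) F)"
proof -
  obtain T where T: "arithmetical (\<lambda>e F. T (e 0) (\<lambda>i. e (Suc i)) (F 0) (\<lambda>j. F (Suc j)))" "tree_local T"
    "\<And>e F. P e F \<longleftrightarrow> (\<exists>u. \<forall>n. T n e u F)"
    using assms(1) unfolding treeform_def by blast
  let ?S = "\<lambda>n e u F. \<forall>m. m < n \<longrightarrow> T m (e(v := u 0)) (\<lambda>k. u (Suc k)) F"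
  show ?thesis
  proof (rule treeformI)
    show "arithmetical (\<lambda>e F. ?S (e 0) (\<lambda>i. e (Suc i)) (F 0) (\<lambda>j. F (Suc j)))"
      by (intro definable_intros arithmetical_tree[OF T(1)])
    show "?S n e u F = ?S n e u' F'"
      if u: "\<And>k. k < n \<Longrightarrow> u k = u' k" and F: "\<And>j k. k < n \<Longrightarrow> F j k = F' j k" for n e u u' F F'
    proof -
      have "T m (e(v := u 0)) (\<lambda>k. u (Suc k)) F = T m (e(v := u' 0)) (\<lambda>k. u' (Suc k)) F'"
        if m: "m < n" for m
      proof -
        have "u 0 = u' 0" "\<forall>k<m. u (Suc k) = u' (Suc k)" "\<forall>j. \<forall>k<m. F j k = F' j k"
          using u F m by auto
        moreover from this have "T m (e(v := u' 0)) (\<lambda>k. u (Suc k)) F = T m (e(v := u' 0)) (\<lambda>k. u' (Suc k)) F'"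
          by (auto intro!: tree_localD[OF T(2)])
        ultimately show ?thesis by simp
      qed
      then show ?thesis by auto
    qed
    show "(\<exists>b. P (e(v := b)) F) \<longleftrightarrow> (\<exists>u. \<forall>n. ?S n e u F)" for e F
    proof
      assume "\<exists>b. P (e(v := b)) F"
      then obtain b w where w: "\<And>n. T n (e(v := b)) w F" unfolding T(3) by metis
      then show "\<exists>u. \<forall>n. ?S n e u F" by (intro exI[of _ "case_nat b w"]) simp
    next
      assume "\<exists>u. \<forall>n. ?S n e u F"
      then obtain u where u: "\<And>n. ?S n e u F" by blast
      have "T m (e(v := u 0)) (\<lambda>k. u (Suc k)) F" for m
        using u[of "Suc m"] by simp
      then show "\<exists>b. P (e(v := b)) F" unfolding T(3) by (intro exI allI)
    qed
  qed
qed

text \<open>The negations are carried along because \<open>treeform\<close> is not closed under \<open>Neg\<close> by itself.\<close>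

lemma treeform_sat: "treeform (\<lambda>e F. sat e F \<phi>) \<and> treeform (\<lambda>e F. \<not> sat e F \<phi>)"
proof (induction \<phi>)
  case (Eq s t)
  show ?case using treeform_atom[of s t True] treeform_atom[of s t False] by simp
next
  case (Conj \<phi> \<psi>)
  then show ?case
    using treeform_conj[of "\<lambda>e F. sat e F \<phi>" "\<lambda>e F. sat e F \<psi>"]
      treeform_disj[of "\<lambda>e F. \<not> sat e F \<phi>" "\<lambda>e F. \<not> sat e F \<psi>"] by simp
next
  case (All v \<phi>)
  then show ?case
    using treeform_all[of "\<lambda>e F. sat e F \<phi>" v] treeform_ex[of "\<lambda>e F. \<not> sat e F \<phi>" v] by simp
qed simp

section \<open>Stages of an exhausting monotone operator\<close>

text \<open>The second assumption says that the least fixed point is the whole type.\<close>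

locale exhausting_operator =
  fixes \<Gamma> :: "'a set \<Rightarrow> 'a set"
  assumes mono: "X \<subseteq> Y \<Longrightarrow> \<Gamma> X \<subseteq> \<Gamma> Y"
    and exhaust: "\<Gamma> X \<subseteq> X \<Longrightarrow> X = UNIV"
begin

text \<open>The transfinite iterates of \<open>\<Gamma>\<close>, generated as a tower without
  ordinals; the empty union starts the iteration.\<close>

inductive stage :: "'a set \<Rightarrow> bool" where
  step: "stage X \<Longrightarrow> stage (X \<union> \<Gamma> X)"
| Union: "(\<And>X. X \<in> C \<Longrightarrow> stage X) \<Longrightarrow> stage (\<Union>C)"

text \<open>The notion by which the Bourbaki-Witt argument shows such a tower to be a chain.\<close>

definition extreme where
  "extreme X \<longleftrightarrow> (\<forall>Y. stage Y \<longrightarrow> Y \<subset> X \<longrightarrow> \<Gamma> Y \<subseteq> X)"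

lemma extreme_cases:
  assumes "stage Y" and "extreme X"
  shows "Y \<subseteq> X \<or> X \<union> \<Gamma> X \<subseteq> Y"
  using assms(1)
proof induction
  case (step Y)
  consider "Y \<subset> X" | "Y = X" | "X \<union> \<Gamma> X \<subseteq> Y" using step.IH by blast
  then show ?case
  proof cases
    case 1
    then show ?thesis using step.hyps assms(2) unfolding extreme_def by blast
  qed auto
next
  case (Union C)
  then show ?case by blast
qed

lemma stage_extreme:
  assumes "stage X"
  shows "extreme X"
  using assms
proof induction
  case (step X)
  show ?case
    unfolding extreme_def
  proof (intro allI impI)
    fix Y
    assume "stage Y" "Y \<subset> X \<union> \<Gamma> X"
    then have "Y \<subseteq> X" using extreme_cases[of Y X] step.IH by blast
    then show "\<Gamma> Y \<subseteq> X \<union> \<Gamma> X" using mono by blast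
  qed
next
  case (Union C)
  show ?case
    unfolding extreme_def
  proof (intro allI impI)
    fix Y
    assume Y: "stage Y" "Y \<subset> \<Union>C"
    then obtain X where X: "X \<in> C" "\<not> X \<subseteq> Y" by blast
    have "extreme X" using Union(2) X(1) by blast
    then have "Y \<subset> X" using extreme_cases[of Y X] Y(1) X(2) by blast
    then have "\<Gamma> Y \<subseteq> X" using \<open>extreme X\<close> Y(1) unfolding extreme_def by blast
    then show "\<Gamma> Y \<subseteq> \<Union>C" using X(1) by blast
  qed
qed

lemma stage_le_next: "stage X \<Longrightarrow> X \<subseteq> \<Gamma> X"
proof (induction rule: stage.induct)
  case (step X)
  then show ?case using mono[of X "X \<union> \<Gamma> X"] by blast
next
  case (Union C)
  then show ?case using mono[of _ "\<Union>C"] by blast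
qed

lemma stage_linear: "stage X \<Longrightarrow> stage Y \<Longrightarrow> Y \<subseteq> X \<or> X \<union> \<Gamma> X \<subseteq> Y"
  by (rule extreme_cases[OF _ stage_extreme])

definition stage_le where
  "stage_le p q \<longleftrightarrow> (\<forall>X. stage X \<longrightarrow> q \<in> X \<longrightarrow> p \<in> X)"

text \<open>The elements entering strictly before \<open>q\<close> form the union of all stages
  missing \<open>q\<close>, which is the greatest stage of this kind.\<close>

lemma stage_before: "stage {r. \<not> stage_le q r}"
proof -
  have "{r. \<not> stage_le q r} = \<Union>{X. stage X \<and> q \<notin> X}"
    unfolding stage_le_def by blast
  then show ?thesis by (metis (no_types, lifting) Union mem_Collect_eq)
qed

lemma stage_le_refl: "stage_le q q"
  by (simp add: stage_le_def)

lemma stage_before_greatest: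
  assumes "stage X" and "q \<notin> X"
  shows "X \<subseteq> {r. \<not> stage_le q r}"
  using assms unfolding stage_le_def by blast

text \<open>Otherwise the next stage would still miss \<open>q\<close>, so the greatest stage
  missing \<open>q\<close> would be closed under \<open>\<Gamma>\<close> and hence contain
  everything.\<close>

lemma stage_before_next: "q \<in> \<Gamma> {r. \<not> stage_le q r}"
proof (rule ccontr)
  let ?X = "{r. \<not> stage_le q r}"
  assume "q \<notin> \<Gamma> ?X"
  then have "?X \<union> \<Gamma> ?X \<subseteq> ?X"
    by (intro stage_before_greatest step stage_before) (simp add: stage_le_refl)
  then have "?X = UNIV" by (intro exhaust) simp
  then show False using stage_le_refl by blast
qed

text \<open>The successor of the greatest stage missing \<open>q\<close> is the first stage
  containing \<open>q\<close>, so \<open>p\<close> enters no later than \<open>q\<close> iff it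
  belongs to that successor.\<close>

lemma stage_le_iff: "stage_le p q \<longleftrightarrow> p \<in> \<Gamma> {r. \<not> stage_le q r}"
proof
  assume "stage_le p q"
  moreover have "stage ({r. \<not> stage_le q r} \<union> \<Gamma> {r. \<not> stage_le q r})"
    by (intro step stage_before)
  ultimately have "p \<in> {r. \<not> stage_le q r} \<union> \<Gamma> {r. \<not> stage_le q r}"
    using stage_before_next[of q] unfolding stage_le_def by blast
  then show "p \<in> \<Gamma> {r. \<not> stage_le q r}" using stage_le_next[OF stage_before[of q]] by blast
next
  assume p: "p \<in> \<Gamma> {r. \<not> stage_le q r}"
  show "stage_le p q"
    unfolding stage_le_def
  proof (intro allI impI)
    fix X
    assume X: "stage X" "q \<in> X"
    then have "\<not> X \<subseteq> {r. \<not> stage_le q r}" using stage_le_refl by blast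
    then show "p \<in> X" using stage_linear[OF stage_before X(1), of q] p by blast
  qed
qed

text \<open>Although the recursion equation does not require well-foundedness, it determines the
  relation: by induction along the stages, any solution agrees with the stage comparison.\<close>

lemma stage_le_unique_at:
  assumes E: "\<And>p q. E p q \<longleftrightarrow> p \<in> \<Gamma> {r. \<not> E q r}" and "stage X"
  shows "p \<in> X \<Longrightarrow> (E p q \<longleftrightarrow> stage_le p q) \<and> (E q p \<longleftrightarrow> stage_le q p)"
  using assms(2)
proof (induction arbitrary: p q)
  case (step X)
  show ?case
  proof (cases "p \<in> X \<or> q \<in> X")
    case True
    then show ?thesis using step.IH by blast
  next
    case False
    \<comment> \<open>Here \<open>p\<close> enters exactly at the step after \<open>X\<close>, and
      \<open>q\<close> is not in \<open>X\<close>. The induction hypothesis settles only pairs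
      meeting \<open>X\<close>, so it remains to compute \<open>{r. \<not> E p r}\<close>.\<close>
    let ?B = "{r. \<not> stage_le p r}"
    have "stage ?B" by (rule stage_before)
    moreover have "X \<subseteq> ?B" using stage_before_greatest step.hyps False by blast
    moreover have "p \<notin> ?B" using stage_le_refl by blast
    ultimately have B: "?B = X"
      using stage_linear[OF step.hyps, of ?B] step.prems by blast
    have le_pq: "stage_le p q"
      unfolding stage_le_def
    proof (intro allI impI, rule ccontr)
      fix Y
      assume "stage Y" "q \<in> Y" "p \<notin> Y"
      then have "Y \<subseteq> X" using stage_before_greatest[of Y p] B by simp
      then show False using \<open>q \<in> Y\<close> False by blast
    qed
    have "X \<subseteq> {r. \<not> E q r}"
    proof
      fix r
      assume r: "r \<in> X"
      then have "\<not> stage_le q r" using False step.hyps unfolding stage_le_def by blast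
      then show "r \<in> {r. \<not> E q r}" using step.IH[OF r, of q] by simp
    qed
    then have Epq: "E p q" if "p \<in> \<Gamma> X" for p
      using E mono that by blast
    have pX: "p \<in> \<Gamma> X" using step.prems False by blast
    \<comment> \<open>If \<open>r\<close> is outside \<open>X\<close>, the induction hypothesis puts
      all of \<open>X\<close> into \<open>{s. \<not> E r s}\<close>; as \<open>p\<close> lies in
      \<open>\<Gamma> X\<close>, monotonicity and the equation yield \<open>E p r\<close>.\<close>
    have "{r. \<not> E p r} = X"
    proof
      show "{r. \<not> E p r} \<subseteq> X"
      proof
        fix r
        assume r: "r \<in> {r. \<not> E p r}"
        show "r \<in> X"
        proof (rule ccontr)
          assume "r \<notin> X"
          have "X \<subseteq> {s. \<not> E r s}"
          proof
            fix s
            assume s: "s \<in> X"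
            then have "\<not> stage_le r s" using \<open>r \<notin> X\<close> step.hyps unfolding stage_le_def by blast
            then show "s \<in> {s. \<not> E r s}" using step.IH[OF s, of r] by simp
          qed
          then have "E p r" using E mono pX by blast
          then show False using r by blast
        qed
      qed
      show "X \<subseteq> {r. \<not> E p r}"
      proof
        fix r
        assume r: "r \<in> X"
        then have "\<not> stage_le p r" using B by blast
        then show "r \<in> {r. \<not> E p r}" using step.IH[OF r, of p] by simp
      qed
    qed
    then have "E q p \<longleftrightarrow> stage_le q p" using E[of q p] stage_le_iff[of q p] B by simp
    then show ?thesis using le_pq Epq[OF pX] by simp
  qed
next
  case (Union C)
  then show ?case by blast
qed

lemma stage_UNIV: "stage UNIV"
proof -
  have "stage (\<Union>{X. stage X})" by (rule Union) simp
  moreover from step[OF this] have "\<Gamma> (\<Union>{X. stage X}) \<subseteq> \<Union>{X. stage X}" by blast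
  ultimately show ?thesis using exhaust by metis
qed

lemma stage_le_unique:
  assumes "\<And>p q. E p q \<longleftrightarrow> p \<in> \<Gamma> {r. \<not> E q r}"
  shows "E = stage_le"
  using stage_le_unique_at[OF assms stage_UNIV] by blast

text \<open>The union of all stages disjoint from \<open>S\<close> cannot be closed under
  \<open>\<Gamma>\<close>, so its successor meets \<open>S\<close>; whatever enters there is
  earliest.\<close>

lemma stage_le_minimum:
  assumes "S \<noteq> {}"
  obtains p where "p \<in> S" and "\<And>q. q \<in> S \<Longrightarrow> stage_le p q"
proof -
  let ?U = "\<Union>{X. stage X \<and> X \<inter> S = {}}"
  have U: "stage ?U" by (rule Union) simp
  have "\<Gamma> ?U \<inter> S \<noteq> {}"
  proof
    assume "\<Gamma> ?U \<inter> S = {}"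
    then have "(?U \<union> \<Gamma> ?U) \<inter> S = {}" by blast
    then have "\<Gamma> ?U \<subseteq> ?U" using step[OF U] by blast
    then have "?U = UNIV" by (rule exhaust)
    then show False using assms by blast
  qed
  then obtain p where p: "p \<in> \<Gamma> ?U" "p \<in> S" by blast
  have "stage_le p q" if "q \<in> S" for q
    unfolding stage_le_def
  proof (intro allI impI)
    fix X
    assume X: "stage X" "q \<in> X"
    then have "\<not> X \<subseteq> ?U" using that by blast
    then show "p \<in> X" using stage_linear[OF U X(1)] p by blast
  qed
  with p(2) show thesis by (rule that)
qed

end

section \<open>The derivative of a tree with countable projection\<close>

text \<open>Every number codes an infinite sequence, and every finite prefix can be prescribed. Thus
  no condition of well-formedness arises.\<close>

primrec dseq :: "nat \<Rightarrow> nat \<Rightarrow> nat" where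
  "dseq 0 p = fst (prod_decode p)"
| "dseq (Suc k) p = dseq k (snd (prod_decode p))"

declare dseq.simps [simp del]

lemma ex_dseq: "\<exists>p. \<forall>k<n. dseq k p = u k"
proof (induction n arbitrary: u)
  case (Suc n)
  obtain p where "\<forall>k<n. dseq k p = u (Suc k)" using Suc.IH[of "\<lambda>k. u (Suc k)"] by blast
  then have "\<forall>k<Suc n. dseq k (prod_encode (u 0, p)) = u k"
    by (auto simp: less_Suc_eq_0_disj dseq.simps)
  then show ?case by blast
qed simp

text \<open>A number \<open>p\<close> is read as the finite sequence of length \<open>d 0 p\<close> with entries \<open>d (Suc k) p\<close>.
  The decoding function is kept variable since it enters the formulas as a quantified
  function; it is \<open>dseq\<close> in the end.\<close>

context
  fixes d :: "nat \<Rightarrow> nat \<Rightarrow> nat" and T :: "nat \<Rightarrow> baire \<Rightarrow> bool"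
begin

definition tnode :: "nat \<Rightarrow> bool" where
  "tnode p \<longleftrightarrow> (\<forall>m. m \<le> d 0 p \<longrightarrow> T m (\<lambda>k. d (Suc k) p))"

definition extends :: "nat \<Rightarrow> nat \<Rightarrow> bool" where
  "extends q p \<longleftrightarrow> d 0 p \<le> d 0 q \<and> (\<forall>k. k < d 0 p \<longrightarrow> d (Suc k) q = d (Suc k) p)"

text \<open>Only positions \<open>pr 0 j\<close> count, as they carry the projection; a difference
  in Skolem functions alone is no splitting.\<close>

definition split :: "nat \<Rightarrow> nat \<Rightarrow> bool" where
  "split q r \<longleftrightarrow> (\<exists>j. pr 0 j < d 0 q \<and> pr 0 j < d 0 r \<and> \<not> d (Suc (pr 0 j)) q = d (Suc (pr 0 j)) r)"

definition splitting :: "nat \<Rightarrow> nat \<Rightarrow> nat \<Rightarrow> bool" where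
  "splitting p q r \<longleftrightarrow> tnode q \<and> tnode r \<and> extends q p \<and> extends r p \<and> split q r"

text \<open>The recursion equation of the comparison of removal stages, \<open>E p q\<close> meaning that \<open>p\<close> is removed
  no later than \<open>q\<close>.\<close>

definition ranks :: "(nat \<Rightarrow> nat \<Rightarrow> bool) \<Rightarrow> bool" where
  "ranks E \<longleftrightarrow> (\<forall>p q. E p q \<longleftrightarrow> (\<forall>r s. splitting p r s \<longrightarrow> \<not> E q r \<or> \<not> E q s))"

text \<open>Values are read off extensions of \<open>p\<close> still present when \<open>p\<close>
  is removed. Where none is long enough the value is 0, so that every \<open>p\<close> selects a
  point.\<close>

definition selects :: "(nat \<Rightarrow> nat \<Rightarrow> bool) \<Rightarrow> nat \<Rightarrow> baire \<Rightarrow> bool" where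
  "selects E p y \<longleftrightarrow> (\<forall>j.
     (\<exists>q. tnode q \<and> extends q p \<and> E p q \<and> pr 0 j < d 0 q \<and> d (Suc (pr 0 j)) q = y j) \<or>
     (y j = 0 \<and> \<not> (\<exists>q. tnode q \<and> extends q p \<and> E p q \<and> pr 0 j < d 0 q)))"

text \<open>One step of the derivative: the nodes that do not split outside \<open>X\<close>, the nodes removed so far.\<close>

definition removed :: "nat set \<Rightarrow> nat set" where
  "removed X = {p. \<forall>r s. splitting p r s \<longrightarrow> r \<in> X \<or> s \<in> X}"

end

section \<open>Exhaustion and selection for a countable projection\<close>

context
  fixes T :: "nat \<Rightarrow> baire \<Rightarrow> bool"
  assumes local: "\<And>n u v. (\<And>k. k < n \<Longrightarrow> u k = v k) \<Longrightarrow> T n u = T n v"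
    and countable: "countable {\<lambda>j. u (pr 0 j) | u. \<forall>n. T n u}"
begin

text \<open>Instead of a perfect set, a single branch is built by diagonalisation: of two extensions
  with incompatible projections, at least one disagrees with the next point of an enumeration of the
  countable projection.\<close>

lemma removed_exhausts:
  assumes "removed dseq T X \<subseteq> X"
  shows "X = UNIV"
proof (rule ccontr)
  assume "X \<noteq> UNIV"
  then obtain p0 where "p0 \<notin> X" by blast
  have split_avoiding: "\<exists>q. q \<notin> X \<and> tnode dseq T q \<and> extends dseq q p \<and> dseq 0 p < dseq 0 q \<and>
      (\<exists>j. pr 0 j < dseq 0 q \<and> dseq (Suc (pr 0 j)) q \<noteq> a j)" if "p \<notin> X" for p and a :: baire
  proof -
    have "p \<notin> removed dseq T X" using assms that by blast
    then obtain q r where "splitting dseq T p q r" "q \<notin> X" "r \<notin> X"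
      unfolding removed_def by blast
    then obtain j where j: "pr 0 j < dseq 0 q" "pr 0 j < dseq 0 r"
        "dseq (Suc (pr 0 j)) q \<noteq> dseq (Suc (pr 0 j)) r"
      and q: "q \<notin> X" "tnode dseq T q" "extends dseq q p"
      and r: "r \<notin> X" "tnode dseq T r" "extends dseq r p"
      unfolding splitting_def split_def by blast
    \<comment> \<open>Below the length of \<open>p\<close> both extensions agree with
      \<open>p\<close>. The lengths therefore grow strictly, and the nodes chosen later determine an
      infinite branch.\<close>
    have "dseq 0 p \<le> pr 0 j"
    proof (rule ccontr)
      assume "\<not> dseq 0 p \<le> pr 0 j"
      then show False using j(3) q(3) r(3) unfolding extends_def by simp
    qed
    then have len: "dseq 0 p < dseq 0 q" "dseq 0 p < dseq 0 r" using j(1,2) by simp_all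
    have "dseq (Suc (pr 0 j)) q \<noteq> a j \<or> dseq (Suc (pr 0 j)) r \<noteq> a j"
      using j(3) by auto
    then show ?thesis
    proof
      assume "dseq (Suc (pr 0 j)) q \<noteq> a j"
      then show ?thesis using q len j by blast
    next
      assume "dseq (Suc (pr 0 j)) r \<noteq> a j"
      then show ?thesis using r len j by blast
    qed
  qed
  let ?A = "{\<lambda>j. u (pr 0 j) | u. \<forall>n. T n u}"
  define a where "a = from_nat_into ?A"
  have a: "?A \<subseteq> range a"
  proof (cases "?A = {}")
    case False
    from range_from_nat_into[OF this countable] show ?thesis by (simp only: a_def subset_refl)
  qed (simp only: empty_subsetI)
  \<comment> \<open>The start \<open>p0\<close> need not be a node of the tree, so
    \<open>tnode\<close> is required only of successors.\<close>
  have "\<exists>P. \<forall>n. P n \<notin> X \<and> (tnode dseq T (P (Suc n)) \<and>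
      extends dseq (P (Suc n)) (P n) \<and> dseq 0 (P n) < dseq 0 (P (Suc n)) \<and>
      (\<exists>j. pr 0 j < dseq 0 (P (Suc n)) \<and> dseq (Suc (pr 0 j)) (P (Suc n)) \<noteq> a n j))"
    by (rule dependent_nat_choice) (use \<open>p0 \<notin> X\<close> split_avoiding in blast)+
  then obtain P where P: "\<And>n. tnode dseq T (P (Suc n))" "\<And>n. extends dseq (P (Suc n)) (P n)"
    "\<And>n. dseq 0 (P n) < dseq 0 (P (Suc n))"
    "\<And>n. \<exists>j. pr 0 j < dseq 0 (P (Suc n)) \<and> dseq (Suc (pr 0 j)) (P (Suc n)) \<noteq> a n j"
    by blast
  have len: "n \<le> dseq 0 (P n)" for n
  proof (induction n)
    case (Suc n)
    then show ?case using P(3)[of n] by linarith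
  qed simp
  have ext: "extends dseq (P (n + m)) (P n)" for n m
  proof (induction m)
    case (Suc m)
    then show ?case using P(2)[of "n + m"] unfolding extends_def
      by auto
  qed (simp add: extends_def)
  \<comment> \<open>\<open>P (Suc k)\<close> has length at least \<open>Suc k\<close>, so its entry
    number \<open>k\<close> is within its length.\<close>
  define u where "u k = dseq (Suc k) (P (Suc k))" for k
  have u: "u k = dseq (Suc k) (P n)" if "k < dseq 0 (P n)" for k n
  proof (cases "n \<le> Suc k")
    case True
    then show ?thesis using ext[of n "Suc k - n"] that unfolding u_def extends_def by simp
  next
    case False
    then have "extends dseq (P n) (P (Suc k))" using ext[of "Suc k" "n - Suc k"] by simp
    moreover have "k < dseq 0 (P (Suc k))" using len[of "Suc k"] by simp
    ultimately show ?thesis unfolding u_def extends_def by simp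
  qed
  have "T n u" for n
  proof -
    have n: "n \<le> dseq 0 (P (Suc n))" using len[of "Suc n"] by simp
    then have "T n (\<lambda>k. dseq (Suc k) (P (Suc n)))" using P(1)[of n] unfolding tnode_def by blast
    moreover have "T n u = T n (\<lambda>k. dseq (Suc k) (P (Suc n)))"
      using u n by (intro local) simp
    ultimately show ?thesis by simp
  qed
  then have "(\<lambda>j. u (pr 0 j)) \<in> range a" using a by blast
  then obtain n where n: "(\<lambda>j. u (pr 0 j)) = a n" by blast
  obtain j where "pr 0 j < dseq 0 (P (Suc n))" "dseq (Suc (pr 0 j)) (P (Suc n)) \<noteq> a n j"
    using P(4) by blast
  then show False using u fun_cong[OF n, of j] by simp
qed

interpretation exhausting_operator "removed dseq T"
proof
  show "removed dseq T X \<subseteq> removed dseq T Y" if "X \<subseteq> Y" for X Y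
    using that unfolding removed_def by blast
qed (rule removed_exhausts)

lemma ranks_iff: "ranks dseq T E \<longleftrightarrow> E = stage_le"
proof
  assume "ranks dseq T E"
  then have "E p q \<longleftrightarrow> p \<in> removed dseq T {r. \<not> E q r}" for p q
    unfolding ranks_def removed_def mem_Collect_eq by (elim allE)
  then show "E = stage_le" by (rule stage_le_unique)
next
  assume E: "E = stage_le"
  show "ranks dseq T E"
    unfolding ranks_def E
  proof (intro allI)
    fix p q
    show "stage_le p q \<longleftrightarrow> (\<forall>r s. splitting dseq T p r s \<longrightarrow> \<not> stage_le q r \<or> \<not> stage_le q s)"
      using stage_le_iff[of p q] unfolding removed_def by blast
  qed
qed

lemma ex1_ranks: "\<exists>!E. ranks dseq T E"
  by (simp add: ranks_iff)

text \<open>By reflexivity \<open>E p p\<close> holds, and its recursion equation says precisely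
  that no two extensions present at the removal of \<open>p\<close> split.\<close>

lemma compatible:
  assumes "ranks dseq T E" and "tnode dseq T q" "extends dseq q p" "E p q"
    and "tnode dseq T r" "extends dseq r p" "E p r"
  shows "\<not> split dseq q r"
proof
  assume "split dseq q r"
  then have "splitting dseq T p q r" using assms unfolding splitting_def by blast
  moreover have "E = stage_le" using assms(1) ranks_iff by simp
  then have "E p p" using stage_le_refl by simp
  moreover have "E p p \<longleftrightarrow> (\<forall>r s. splitting dseq T p r s \<longrightarrow> \<not> E p r \<or> \<not> E p s)"
    using assms(1) unfolding ranks_def by (elim allE)
  ultimately show False using assms(4,7) by blast
qed

lemma ex1_selects:
  assumes "ranks dseq T E"
  shows "\<exists>!y. selects dseq T E p y"
proof
  let ?G = "\<lambda>j q. tnode dseq T q \<and> extends dseq q p \<and> E p q \<and> pr 0 j < dseq 0 q"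
  let ?y = "\<lambda>j. if \<exists>q. ?G j q then dseq (Suc (pr 0 j)) (SOME q. ?G j q) else 0"
  show "selects dseq T E p ?y"
    unfolding selects_def
  proof
    fix j
    show "(\<exists>q. tnode dseq T q \<and> extends dseq q p \<and> E p q \<and> pr 0 j < dseq 0 q \<and>
          dseq (Suc (pr 0 j)) q = ?y j) \<or> (?y j = 0 \<and> \<not> (\<exists>q. ?G j q))"
    proof (cases "\<exists>q. ?G j q")
      case True
      then have "?G j (SOME q. ?G j q)" by (rule someI_ex)
      with True show ?thesis by auto
    qed auto
  qed
  fix y
  assume y: "selects dseq T E p y"
  show "y = ?y"
  proof
    fix j
    show "y j = ?y j"
    proof (cases "\<exists>q. ?G j q")
      case True
      then have some: "?G j (SOME q. ?G j q)" by (rule someI_ex)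
      obtain q where q: "?G j q" "dseq (Suc (pr 0 j)) q = y j"
        using y True unfolding selects_def by blast
      have "\<not> split dseq q (SOME q. ?G j q)"
        using some q(1) by (intro compatible[OF assms]) auto
      then show ?thesis using True some q unfolding split_def by auto
    next
      case False
      then show ?thesis using y unfolding selects_def by auto
    qed
  qed
qed

lemma ex_selects:
  assumes E: "ranks dseq T E" and u: "\<And>n. T n u"
  shows "\<exists>p. selects dseq T E p (\<lambda>j. u (pr 0 j))"
proof -
  have "\<exists>p. dseq 0 p = n \<and> (\<forall>k<n. dseq (Suc k) p = u k)" for n
  proof -
    obtain p where "\<And>k. k < Suc n \<Longrightarrow> dseq k p = case_nat n u k"
      using ex_dseq[of "Suc n" "case_nat n u"] by blast
    from this[of 0] this[of "Suc _"] have "dseq 0 p = n \<and> (\<forall>k<n. dseq (Suc k) p = u k)"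
      by simp
    then show ?thesis ..
  qed
  then obtain P where P: "\<And>n. dseq 0 (P n) = n" "\<And>n k. k < n \<Longrightarrow> dseq (Suc k) (P n) = u k"
    by metis
  have node: "tnode dseq T (P n)" for n
    unfolding tnode_def
  proof (intro allI impI)
    fix m
    assume "m \<le> dseq 0 (P n)"
    then have "T m (\<lambda>k. dseq (Suc k) (P n)) = T m u" by (intro local) (simp add: P)
    then show "T m (\<lambda>k. dseq (Suc k) (P n))" using u by simp
  qed
  have "E = stage_le" using E ranks_iff by simp
  have "range P \<noteq> {}" by simp
  then obtain p0 where "p0 \<in> range P" and p0: "\<And>q. q \<in> range P \<Longrightarrow> stage_le p0 q"
    by (rule stage_le_minimum) blast
  then obtain n0 where "p0 = P n0" by blast
  with p0 have n0: "\<And>n. E (P n0) (P n)" using \<open>E = stage_le\<close> by simp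
  have ext: "extends dseq (P n) (P n0)" if "n0 \<le> n" for n
    using that unfolding extends_def by (simp add: P)
  have "\<exists>q. tnode dseq T q \<and> extends dseq q (P n0) \<and> E (P n0) q \<and> pr 0 j < dseq 0 q \<and>
      dseq (Suc (pr 0 j)) q = u (pr 0 j)" for j
  proof (intro exI conjI)
    \<comment> \<open>Long enough both to extend \<open>P n0\<close> and to reach position
      \<open>pr 0 j\<close>.\<close>
    let ?q = "P (max n0 (Suc (pr 0 j)))"
    show "tnode dseq T ?q" by (rule node)
    show "extends dseq ?q (P n0)" by (rule ext) simp
    show "E (P n0) ?q" by (rule n0)
    show "pr 0 j < dseq 0 ?q" by (simp add: P)
    show "dseq (Suc (pr 0 j)) ?q = u (pr 0 j)" by (rule P) simp
  qed
  then show ?thesis unfolding selects_def by blast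
qed

end

section \<open>Uniform codes\<close>

text \<open>\<open>prod_encode\<close> is not a term of the language, but its graph is arithmetical,
  which is enough for equations.\<close>

definition num_definable :: "((nat \<Rightarrow> nat) \<Rightarrow> (nat \<Rightarrow> baire) \<Rightarrow> nat) \<Rightarrow> bool" where
  "num_definable t \<longleftrightarrow> arithmetical (\<lambda>e F. e 0 = t (\<lambda>i. e (Suc i)) F)"

lemma num_definable_tmd: "tm_definable t \<Longrightarrow> num_definable t"
  unfolding num_definable_def by (intro definable_intros tm_definable_shift)

lemma num_definable_eq:
  assumes "num_definable s" and "num_definable t"
  shows "arithmetical (\<lambda>e F. s e F = t e F)"
proof -
  have "arithmetical (\<lambda>e F. \<exists>a. a = s e F \<and> a = t e F)"
    using assms unfolding num_definable_def by (intro arithmetical_ex arithmetical_conj)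
  then show ?thesis by simp
qed

lemma num_definable_prod_encode:
  assumes "num_definable s" and "num_definable t"
  shows "num_definable (\<lambda>e F. prod_encode (s e F, t e F))"
proof -
  have *: "arithmetical (\<lambda>e F. e m = r (\<lambda>i. e (Suc (Suc (Suc i)))) F)" if "num_definable r" for m r
  proof -
    have "fun_definable (\<lambda>e F. F j)" for j by (intro definable_intros)
    then show ?thesis
      using arithmetical_subst[OF that[unfolded num_definable_def],
          where \<eta> = "\<lambda>e F. case_nat (e m) (\<lambda>i. e (Suc (Suc (Suc i))))" and \<theta> = "\<lambda>e F. F"]
      by (simp add: tm_definable_case_env tm_definable_var)
  qed
  \<comment> \<open>Doubling clears the division in the triangular number and leaves a polynomial
    equation.\<close>
  have enc: "r = prod_encode (a, b) \<longleftrightarrow> r + r = (a + b) * Suc (a + b) + (a + a)" for r a b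
  proof -
    have "triangle (a + b) + triangle (a + b) = (a + b) * Suc (a + b)"
      unfolding triangle_def by (metis dvd_mult_div_cancel even_mult_iff even_Suc mult_2)
    then show ?thesis unfolding prod_encode_def by auto
  qed
  have "arithmetical (\<lambda>e F. \<exists>a b. b = s (\<lambda>i. e (Suc i)) F \<and> a = t (\<lambda>i. e (Suc i)) F \<and>
      e 0 + e 0 = (b + a) * Suc (b + a) + (b + b))"
    by (intro arithmetical_ex arithmetical_conj *[OF assms(1)] *[OF assms(2)] definable_intros)
  then show ?thesis unfolding num_definable_def enc by simp
qed

lemma arithmetical_fun_eq:
  fixes f g :: "(nat \<Rightarrow> nat) \<Rightarrow> (nat \<Rightarrow> baire) \<Rightarrow> baire"
  assumes "fun_definable f" and "fun_definable g"
  shows "arithmetical (\<lambda>e F. f e F = g e F)"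
proof -
  have "arithmetical (\<lambda>e F. \<forall>k. f e F k = g e F k)"
    using assms unfolding fun_definable_def by (intro arithmetical_all arithmetical_eq)
  then show ?thesis by (simp add: fun_eq_iff)
qed

lemma sigma_definable_ex_num:
  assumes "sigma_definable (\<lambda>e F. P (e 0) (\<lambda>i. e (Suc i)) F)"
  shows "sigma_definable (\<lambda>e F. \<exists>a. P a e F)"
proof -
  obtain Q where Q: "arithmetical Q"
    "\<And>e F. P (e 0) (\<lambda>i. e (Suc i)) F \<longleftrightarrow> (\<exists>z. Q e (case_nat z F))"
    using assms unfolding sigma_definable_def by blast
  have "arithmetical (\<lambda>e F. Q (case_nat (e 0) (\<lambda>i. e (Suc i))) F)"
    by (rule arithmetical_subst[OF Q(1)]) (intro definable_intros)+
  then have "arithmetical (\<lambda>e F. \<exists>a. Q (case_nat a e) F)"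
    by (rule arithmetical_ex)
  moreover have "(\<exists>a. P a e F) \<longleftrightarrow> (\<exists>z a. Q (case_nat a e) (case_nat z F))" for e F
    using Q(2)[of "case_nat _ e" F] by auto
  ultimately show ?thesis
    unfolding sigma_definable_def by (intro
        exI[of _ "\<lambda>e F. \<exists>a. Q (case_nat a e) F"]) simp
qed

lemma sigma_definable_formula:
  assumes "sigma_definable P"
  obtains \<phi> where "\<And>e F. P e F \<longleftrightarrow> (\<exists>z. sat e (case_nat z F) \<phi>)"
  using assms unfolding sigma_definable_def arithmetical_def by metis

section \<open>Goedel numbers of numeral instances\<close>

primrec numeral_tm :: "nat \<Rightarrow> tm" where
  "numeral_tm 0 = Zero"
| "numeral_tm (Suc n) = Succ (numeral_tm n)"

lemma tm_val_numeral_tm [simp]: "tm_val e F (numeral_tm n) = n"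
  by (induction n) auto

text \<open>The index enters through an equation with a numeral under an existential quantifier, not
  by substitution, so the Goedel number depends on \<open>i\<close> only through that of the
  numeral.\<close>

definition instance_fm :: "nat \<Rightarrow> fm \<Rightarrow> fm" where
  "instance_fm i \<phi> = Neg (All 0 (Neg (Conj (Eq (Var 0) (numeral_tm i)) \<phi>)))"

lemma sat_instance_fm: "sat e F (instance_fm i \<phi>) \<longleftrightarrow> sat (e(0 := i)) F \<phi>"
  by (auto simp: instance_fm_def)

text \<open>The codes of the numerals are the unique solution of an arithmetical recursion.
  Quantifying over that solution gives Sigma^1_1 definitions of the graph and of its
  complement.\<close>

lemma sigma_definable_code_seq:
  fixes \<phi> \<psi> :: fm
  defines "c \<equiv> \<lambda>i. prod_encode (fm_code (instance_fm i \<phi>), fm_code (instance_fm i \<psi>))"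
  shows "sigma_definable (\<lambda>e F. e 1 = c (e 0))" and "sigma_definable (\<lambda>e F. \<not> e 1 = c (e 0))"
proof -
  define rec where "rec w \<longleftrightarrow> w 0 = tm_code Zero \<and> (\<forall>j. w (Suc j) = prod_encode (2, w j))"
    for w :: baire
  define code where "code n \<theta> = prod_encode (1, prod_encode (3, prod_encode (0, prod_encode (1,
    prod_encode (2, prod_encode (prod_encode (0, prod_encode (tm_code (Var 0), n)), fm_code \<theta>))))))"
    for n \<theta>
  have "w = (\<lambda>i. tm_code (numeral_tm i))" if "rec w" for w
  proof
    show "w i = tm_code (numeral_tm i)" for i
      using that unfolding rec_def by (induction i) auto
  qed
  moreover have "rec (\<lambda>i. tm_code (numeral_tm i))"
    unfolding rec_def by simp
  moreover have c: "c i = prod_encode (code (tm_code (numeral_tm i)) \<phi>, code (tm_code (numeral_tm i)) \<psi>)" for i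
    unfolding c_def code_def instance_fm_def by simp
  ultimately have iff: "r = c i \<longleftrightarrow> (\<exists>w. rec w \<and> r = prod_encode (code (w i) \<phi>, code (w i) \<psi>))"
    "\<not> r = c i \<longleftrightarrow> (\<exists>w. rec w \<and> \<not> r = prod_encode (code (w i) \<phi>, code (w i) \<psi>))" for r i
    by auto
  have rec: "arithmetical (\<lambda>e F. rec (F 0))"
    unfolding rec_def by (intro arithmetical_conj arithmetical_all num_definable_eq
        num_definable_prod_encode num_definable_tmd definable_intros)
  have val: "arithmetical (\<lambda>e F. e 1 = prod_encode (code (F 0 (e 0)) \<phi>, code (F 0 (e 0)) \<psi>))"
    unfolding code_def by (intro num_definable_eq num_definable_prod_encode; intro
        num_definable_tmd definable_intros)
  show "sigma_definable (\<lambda>e F. e 1 = c (e 0))"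
    unfolding iff(1) by (intro sigma_definable_ex_fun sigma_definable_arith arithmetical_conj rec
        val)
  show "sigma_definable (\<lambda>e F. \<not> e 1 = c (e 0))"
    unfolding iff(2) by (intro sigma_definable_ex_fun sigma_definable_arith arithmetical_conj
        arithmetical_not rec val)
qed

lemma sigma_definable_sigma11_graph:
  assumes "sigma_definable (\<lambda>e F. P (e 0) (e 1))"
  shows "sigma11 2 0 {([i, m], []) | i m. P i m}"
proof -
  obtain \<phi> where \<phi>: "\<And>e F. P (e 0) (e 1) \<longleftrightarrow> (\<exists>z. sat e (case_nat z F) \<phi>)"
    using sigma_definable_formula[OF assms] by blast
  have "{([i, m], []) | i m. P i m} = sigma11_set 2 0 \<phi>"
    unfolding sigma11_set_def pspace_def
    by (auto simp: \<phi>[symmetric] length_Suc_conv numeral_2_eq_2)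
  then show ?thesis unfolding sigma11_def by blast
qed

lemma delta11_code_seq:
  "delta11 2 0 {([i, prod_encode (fm_code (instance_fm i \<phi>), fm_code (instance_fm i \<psi>))], []) | i. True}"
proof -
  define c where "c i = prod_encode (fm_code (instance_fm i \<phi>), fm_code (instance_fm i \<psi>))" for i
  have "sigma11 2 0 {([i, m], []) | i m. m = c i}" "sigma11 2 0 {([i, m], []) | i m. \<not> m = c i}"
    unfolding c_def by (rule sigma_definable_sigma11_graph sigma_definable_code_seq)+
  moreover have "{([i, m], []) | i m. m = c i} = {([i, c i], []) | i. True}"
    by auto
  moreover have "{([i, m], []) | i m. \<not> m = c i} = pspace 2 0 - {([i, c i], []) | i. True}"
    unfolding pspace_def by (auto simp: length_Suc_conv numeral_2_eq_2)
  ultimately show ?thesis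
    unfolding delta11_def c_def[symmetric] by (auto simp: pspace_def)
qed

section \<open>Binary relations on Baire space\<close>

lemma pair_env: "(\<lambda>j. if j < 2 then [x, y] ! j else (\<lambda>_. 0)) = case_nat x (case_nat y (\<lambda>_ _. 0))"
  by (auto simp: fun_eq_iff nth_Cons less_2_cases_iff split: nat.splits)

lemma sigma11_set_pair:
  "([], [x, y]) \<in> sigma11_set 0 2 \<phi> \<longleftrightarrow>
     (\<exists>z. sat (\<lambda>_. 0) (case_nat z (case_nat x (case_nat y (\<lambda>_ _. 0)))) \<phi>)"
  by (simp add: sigma11_set_def pspace_def pair_env[symmetric])

lemma rel_points_iff: "([], [x, y]) \<in> rel_points A \<longleftrightarrow> (x, y) \<in> A"
  by (auto simp: rel_points_def)

lemma rel_points_Compl: "pspace 0 2 - rel_points A = rel_points (- A)"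
  by (auto simp: pspace_def rel_points_def length_Suc_conv numeral_2_eq_2)

lemma rel_points_eqI:
  assumes "\<And>x y. (x, y) \<in> A \<longleftrightarrow> ([], [x, y]) \<in> sigma11_set 0 2 \<phi>"
  shows "rel_points A = sigma11_set 0 2 \<phi>"
  using assms by (auto simp: rel_points_def sigma11_set_def pspace_def length_Suc_conv numeral_2_eq_2)

text \<open>A single formula with the index as number variable 0 serves all \<open>A i\<close>, and
  another serves the complements; their numeral instances form the codes.\<close>

lemma delta11_rel_sequenceI:
  assumes "sigma_definable (\<lambda>e F. (F 0, F 1) \<in> A (e 0))" and "sigma_definable (\<lambda>e F. (F 0, F 1) \<notin> A (e 0))"
  shows "delta11_rel_sequence A"
proof -
  obtain \<phi> where \<phi>: "\<And>e F. (F 0, F 1) \<in> A (e 0) \<longleftrightarrow> (\<exists>z. sat e (case_nat z F) \<phi>)"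
    using sigma_definable_formula[OF assms(1)] by blast
  obtain \<psi> where \<psi>: "\<And>e F. (F 0, F 1) \<notin> A (e 0) \<longleftrightarrow> (\<exists>z. sat e (case_nat z F) \<psi>)"
    using sigma_definable_formula[OF assms(2)] by blast
  have "rel_points (A i) = sigma11_set 0 2 (instance_fm i \<phi>)" for i
    by (rule rel_points_eqI) (simp add: sigma11_set_pair sat_instance_fm \<phi>[symmetric])
  moreover have "rel_points (- A i) = sigma11_set 0 2 (instance_fm i \<psi>)" for i
    by (rule rel_points_eqI) (simp add: sigma11_set_pair sat_instance_fm \<psi>[symmetric])
  ultimately show ?thesis
    unfolding delta11_rel_sequence_def delta11_sequence_def delta11_code_def rel_points_Compl
    using delta11_code_seq[of \<phi> \<psi>]
    by (intro
        exI[of _ "\<lambda>i. prod_encode (fm_code (instance_fm i \<phi>), fm_code (instance_fm i \<psi>))"]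
        conjI allI exI[of _ "instance_fm _ \<phi>"] exI[of _ "instance_fm _ \<psi>"]) auto
qed

lemma sigma_definable_rel:
  assumes "sigma11 0 2 (rel_points A)" and f: "fun_definable f" and g: "fun_definable g"
  shows "sigma_definable (\<lambda>e F. (f e F, g e F) \<in> A)"
proof -
  obtain \<phi> where \<phi>: "rel_points A = sigma11_set 0 2 \<phi>"
    using assms(1) unfolding sigma11_def by blast
  have "arithmetical (\<lambda>e F. sat (\<lambda>_. 0) (case_nat (F 0) (case_nat (F 1) (case_nat (F 2) (\<lambda>_ _. 0)))) \<phi>)"
    by (intro sat_subst definable_intros)
  then have "sigma_definable (\<lambda>e F. \<exists>z. sat (\<lambda>_. 0) (case_nat z (case_nat (F 0) (case_nat (F 1) (\<lambda>_ _. 0)))) \<phi>)"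
    by (intro sigma_definable_ex_fun sigma_definable_arith) (simp add: numeral_2_eq_2)
  then have "sigma_definable (\<lambda>e F. (F 0, F 1) \<in> A)"
    by (simp add: sigma11_set_pair[symmetric] \<phi>[symmetric] rel_points_iff)
  moreover have "fun_definable (\<lambda>e F. case_nat (f e F) (\<lambda>_. g e F) j)" for j
    using f g by (cases j) simp_all
  ultimately show ?thesis
    using sigma_definable_subst[of "\<lambda>e F. (F 0, F 1) \<in> A" "\<lambda>e F. e" "\<lambda>e F. case_nat (f e F) (\<lambda>_. g e F)"]
    by (simp add: tm_definable_var)
qed

text \<open>The second coordinate of a point of the section is the component \<open>pr 0\<close> of a branch.\<close>

lemma sigma11_tree:
  assumes "sigma11 0 2 (rel_points R)"
  obtains T where "arithmetical (\<lambda>e F. T (e 0) (F 0) (F 1))"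
    and "\<And>n u v x. (\<And>k. k < n \<Longrightarrow> u k = v k) \<Longrightarrow> T n u x = T n v x"
    and "\<And>x. {y. (x, y) \<in> R} = {\<lambda>j. u (pr 0 j) | u. \<forall>n. T n u x}"
proof -
  obtain \<phi> where \<phi>: "rel_points R = sigma11_set 0 2 \<phi>"
    using assms(1) unfolding sigma11_def by blast
  obtain S where S: "arithmetical (\<lambda>e F. S (e 0) (\<lambda>i. e (Suc i)) (F 0) (\<lambda>j. F (Suc j)))" "tree_local S"
    "\<And>e F. sat e F \<phi> \<longleftrightarrow> (\<exists>u. \<forall>n. S n e u F)"
    using treeform_sat[of \<phi>] unfolding treeform_def by blast
  let ?F = "\<lambda>z x y. case_nat z (case_nat x (case_nat y (\<lambda>_ _. 0))) :: nat \<Rightarrow> baire"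
  \<comment> \<open>Rows 0, 1 and 2 of the branch are \<open>y\<close>, the Sigma^1_1 witness and
    the Skolem functions; the guard uses row 2, the farthest. The point \<open>x\<close> stays a
    parameter.\<close>
  let ?T = "\<lambda>n u x. \<forall>m. pr 2 m \<le> n \<longrightarrow>
    S m (\<lambda>_. 0) (\<lambda>k. u (pr 2 k)) (?F (\<lambda>k. u (pr 1 k)) x (\<lambda>k. u (pr 0 k)))"
  show thesis
  proof (rule that[of ?T])
    show "arithmetical (\<lambda>e F. ?T (e 0) (F 0) (F 1))"
      by (intro arithmetical_all arithmetical_imp arithmetical_tree[OF S(1)] definable_intros)
    show "?T n u x = ?T n v x" if uv: "\<And>k. k < n \<Longrightarrow> u k = v k" for n u v x
    proof -
      have "S m (\<lambda>_. 0) (\<lambda>k. u (pr 2 k)) (?F (\<lambda>k. u (pr 1 k)) x (\<lambda>k. u (pr 0 k))) =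
        S m (\<lambda>_. 0) (\<lambda>k. v (pr 2 k)) (?F (\<lambda>k. v (pr 1 k)) x (\<lambda>k. v (pr 0 k)))"
        if m: "pr 2 m \<le> n" for m
      proof -
        have less: "pr b k < n" if "b \<le> 2" "k < m" for b k
          using pr_sum_less[of b k 2 m] that m by linarith
        show ?thesis
          by (rule tree_localD[OF S(2)]) (auto intro!: uv less split: nat.split)
      qed
      then show ?thesis by auto
    qed
    fix x
    have "(x, y) \<in> R \<longleftrightarrow> (\<exists>u. y = (\<lambda>j. u (pr 0 j)) \<and> (\<forall>n. ?T n u x))" for y
    proof
      assume "(x, y) \<in> R"
      then obtain z w where zw: "\<And>n. S n (\<lambda>_. 0) w (?F z x y)"
        by (auto simp: rel_points_iff[symmetric] \<phi> sigma11_set_pair S(3))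
      obtain u :: baire where "\<And>b k. u (pr b k) = (if b = 0 then y k else if b = 1 then z k else w k)"
        by (rule combine[of "\<lambda>b k. if b = 0 then y k else if b = 1 then z k else w k"]) blast
      then show "\<exists>u. y = (\<lambda>j. u (pr 0 j)) \<and> (\<forall>n. ?T n u x)"
        using zw by (intro exI[of _ u]) simp
    next
      assume "\<exists>u. y = (\<lambda>j. u (pr 0 j)) \<and> (\<forall>n. ?T n u x)"
      then obtain u where y: "y = (\<lambda>j. u (pr 0 j))" and u: "\<And>n. ?T n u x" by blast
      have "S m (\<lambda>_. 0) (\<lambda>k. u (pr 2 k)) (?F (\<lambda>k. u (pr 1 k)) x y)" for m
        using u[of "pr 2 m"] y by simp
      then show "(x, y) \<in> R"
        unfolding rel_points_iff[symmetric] \<phi> sigma11_set_pair S(3) by blast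
    qed
    then show "{y. (x, y) \<in> R} = {\<lambda>j. u (pr 0 j) | u. \<forall>n. ?T n u x}" by auto
  qed
qed

section \<open>Selectors and involutions\<close>

lemma sigma_definable_stage_selection:
  assumes T: "arithmetical (\<lambda>e F. T (e 0) (F 0) (F 1))"
  shows "sigma_definable (\<lambda>e F. \<exists>E. ranks dseq (\<lambda>n u. T n u (F 0)) E \<and>
    selects dseq (\<lambda>n u. T n u (F 0)) E (e 0) (F 1))"
proof -
  have arithmetical_T: "arithmetical (\<lambda>e F. T (n e F) (u e F) (x e F))" if
      "tm_definable n" "fun_definable u" "fun_definable x" for n u x
  proof -
    have "fun_definable (\<lambda>e F. case_nat (u e F) (\<lambda>_. x e F) j)" for j
      using that by (cases j) simp_all
    then show ?thesis
      using arithmetical_subst[OF T, where \<eta> = "\<lambda>e F _. n e F" and \<theta> = "\<lambda>e F. case_nat (u e F) (\<lambda>_. x e F)"]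
        that by simp
  qed
  \<comment> \<open>An arithmetical recursion with \<open>dseq\<close> as its only solution, stated
    through \<open>prod_encode\<close> because only that graph has been shown arithmetical.\<close>
  define decoder where "decoder z \<longleftrightarrow> (\<forall>p a b k. p = prod_encode (a, b) \<longrightarrow>
    z (pr 0 p) = a \<and> z (pr (Suc k) p) = z (pr k b))" for z :: baire
  have decoder: "(\<lambda>k p. z (pr k p)) = dseq" if "decoder z" for z
  proof -
    have "z (pr k p) = dseq k p" for k p
    proof (induction k arbitrary: p)
      case 0
      show ?case using that prod_decode_inverse[of p] unfolding decoder_def dseq.simps
        by (metis prod.collapse)
    next
      case (Suc k)
      show ?case using that prod_decode_inverse[of p] Suc unfolding decoder_def dseq.simps
        by (metis prod.collapse)
    qed
    then show ?thesis by blast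
  qed
  obtain z0 :: baire where z0: "\<And>k p. z0 (pr k p) = dseq k p"
    by (rule combine[of dseq]) blast
  have "decoder z0"
    unfolding decoder_def by (simp add: z0 dseq.simps)
  \<comment> \<open>A relation is coded by the zeros of a function, so a quantifier over relations
    becomes a function quantifier.\<close>
  let ?E = "\<lambda>w p q. w (pr p q) = (0 :: nat)"
  have ex_E: "(\<exists>E. P E) \<longleftrightarrow> (\<exists>w. P (?E w))" for P :: "(nat \<Rightarrow> nat \<Rightarrow> bool) \<Rightarrow> bool"
  proof
    assume "\<exists>E. P E"
    then obtain E where E: "P E" by blast
    obtain w :: baire where "\<And>p q. w (pr p q) = (if E p q then 0 else 1)"
      by (rule combine[of "\<lambda>p q. if E p q then 0 else 1"]) blast
    then have "?E w = E" by (simp add: fun_eq_iff)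
    with E show "\<exists>w. P (?E w)" by metis
  qed blast
  have iff: "(\<exists>E. ranks dseq S E \<and> selects dseq S E p y) \<longleftrightarrow>
    (\<exists>z w. decoder z \<and> ranks (\<lambda>k p. z (pr k p)) S (?E w) \<and> selects (\<lambda>k p. z (pr k p)) S (?E w) p y)"
    for S p y
  proof -
    have "(\<exists>z. decoder z \<and> P (\<lambda>k p. z (pr k p))) \<longleftrightarrow> P dseq" for P
    proof
      assume "P dseq"
      then show "\<exists>z. decoder z \<and> P (\<lambda>k p. z (pr k p))"
        using \<open>decoder z0\<close> decoder[of z0] by (intro exI[of _ z0]) simp
    next
      assume "\<exists>z. decoder z \<and> P (\<lambda>k p. z (pr k p))"
      then show "P dseq" using decoder by auto
    qed
    from this[of "\<lambda>d. \<exists>w. ranks d S (?E w) \<and> selects d S (?E w) p y"]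
    show ?thesis unfolding ex_E by auto
  qed
  show ?thesis
    unfolding iff unfolding decoder_def ranks_def selects_def splitting_def split_def tnode_def extends_def
    by (intro sigma_definable_ex_fun sigma_definable_arith arithmetical_conj arithmetical_disj
        arithmetical_imp arithmetical_all arithmetical_ex arithmetical_not arithmetical_iff
        arithmetical_T arithmetical_le arithmetical_less num_definable_eq num_definable_prod_encode; intro num_definable_tmd definable_intros)
qed

lemma selector_family:
  assumes "sigma11 0 2 (rel_points R)" and "\<And>x. countable {y. (x, y) \<in> R}"
  obtains c :: "nat \<Rightarrow> baire \<Rightarrow> baire"
  where "sigma_definable (\<lambda>e F. F 1 = c (e 0) (F 0))" and "\<And>x y. (x, y) \<in> R \<Longrightarrow> \<exists>i. y = c i x"
proof -
  obtain T where T: "arithmetical (\<lambda>e F. T (e 0) (F 0) (F 1))"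
    and local: "\<And>n u v x. (\<And>k. k < n \<Longrightarrow> u k = v k) \<Longrightarrow> T n u x = T n v x"
    and R: "\<And>x. {y. (x, y) \<in> R} = {\<lambda>j. u (pr 0 j) | u. \<forall>n. T n u x}"
    by (rule sigma11_tree[OF assms(1)]) blast
  have cnt: "countable {\<lambda>j. u (pr 0 j) | u. \<forall>n. T n u x}" for x
    using assms(2)[of x] unfolding R .
  have "\<exists>E. ranks dseq (\<lambda>n u. T n u x) E" for x
    using ex1_ranks[of "\<lambda>n u. T n u x", OF local cnt] by blast
  then obtain E where E: "\<And>x. ranks dseq (\<lambda>n u. T n u x) (E x)" by metis
  have E_unique: "E' = E x" if "ranks dseq (\<lambda>n u. T n u x) E'" for x E'
    using ex1_ranks[of "\<lambda>n u. T n u x", OF local cnt] that E by blast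
  have ex1: "\<exists>!y. selects dseq (\<lambda>n u. T n u x) (E x) p y" for x p
    by (rule ex1_selects[of "\<lambda>n u. T n u x", OF local cnt E])
  define c where "c p x = (THE y. selects dseq (\<lambda>n u. T n u x) (E x) p y)" for p x
  have c: "selects dseq (\<lambda>n u. T n u x) (E x) p (c p x)" for p x
    unfolding c_def by (rule theI'[OF ex1])
  have c_iff: "y = c p x \<longleftrightarrow> (\<exists>E. ranks dseq (\<lambda>n u. T n u x) E \<and> selects dseq (\<lambda>n u. T n u x) E p y)"
    for y p x
  proof
    assume "y = c p x"
    then show "\<exists>E. ranks dseq (\<lambda>n u. T n u x) E \<and> selects dseq (\<lambda>n u. T n u x) E p y"
      using c[where p = p and x = x] E[of x] by blast
  next
    assume "\<exists>E. ranks dseq (\<lambda>n u. T n u x) E \<and> selects dseq (\<lambda>n u. T n u x) E p y"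
    then have "selects dseq (\<lambda>n u. T n u x) (E x) p y" using E_unique by auto
    then show "y = c p x" using ex1[where p = p and x = x] c[where p = p and x = x] by blast
  qed
  show thesis
  proof (rule that)
    show "sigma_definable (\<lambda>e F. F 1 = c (e 0) (F 0))"
      unfolding c_iff by (rule sigma_definable_stage_selection[OF T])
    fix x y
    assume "(x, y) \<in> R"
    then obtain u where u: "y = (\<lambda>j. u (pr 0 j))" "\<And>n. T n u x" using R[of x] by blast
    have "\<exists>p. selects dseq (\<lambda>n u. T n u x) (E x) p y"
      unfolding u(1) by (rule ex_selects[of "\<lambda>n u. T n u x", OF local cnt E u(2)])
    then show "\<exists>i. y = c i x" using ex1 c by blast
  qed
qed

lemma sigma_definable_family_app:
  fixes c :: "nat \<Rightarrow> baire \<Rightarrow> baire"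
  assumes "sigma_definable (\<lambda>e F. F 1 = c (e 0) (F 0))" and "tm_definable t" and "fun_definable f" and "fun_definable g"
  shows "sigma_definable (\<lambda>e F. f e F = c (t e F) (g e F))"
proof -
  have "fun_definable (\<lambda>e F. case_nat (g e F) (\<lambda>_. f e F) j)" for j
    using assms by (cases j) simp_all
  then show ?thesis
    using sigma_definable_subst[OF assms(1), where \<eta> = "\<lambda>e F _. t e F" and \<theta> = "\<lambda>e F. case_nat (g e F) (\<lambda>_. f e F)"]
      assms(2) by simp
qed

text \<open>The complement of the graph of a total function needs no separate definition.\<close>

lemma delta11_rel_sequence_total:
  assumes "sigma_definable (\<lambda>e F. F 1 = h (e 0) (F 0))"
  shows "delta11_rel_sequence (\<lambda>i. {(x, y). y = h i x})"
proof (rule delta11_rel_sequenceI)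
  have fun_definable: "fun_definable (\<lambda>e F. F j)" for j by (intro definable_intros)
  show "sigma_definable (\<lambda>e F. (F 0, F 1) \<in> {(x, y). y = h (e 0) x})" using assms by simp
  have "sigma_definable (\<lambda>e F. \<exists>y. y = h (e 0) (F 0) \<and> \<not> y = F 1)"
    by (intro sigma_definable_ex_fun sigma_definable_conj sigma_definable_family_app[OF assms]
        sigma_definable_arith[OF arithmetical_not[OF arithmetical_fun_eq]] fun_definable tm_definable_var)
  then show "sigma_definable (\<lambda>e F. (F 0, F 1) \<notin> {(x, y). y = h (e 0) x})"
    by (rule sigma_definable_cong) auto
qed

text \<open>A pair is outside the graph either because it is outside \<open>R\<close> or because the
  selector takes another value; both alternatives are Sigma^1_1.\<close>

lemma delta11_rel_sequence_graph:
  assumes c: "sigma_definable (\<lambda>e F. F 1 = c (e 0) (F 0))"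
    and R: "sigma11 0 2 (rel_points R)" "sigma11 0 2 (rel_points (- R))"
  shows "delta11_rel_sequence (\<lambda>i. {(x, y). y = c i x \<and> (x, y) \<in> R})"
proof (rule delta11_rel_sequenceI)
  have fun_definable: "fun_definable (\<lambda>e F. F j)" for j by (intro definable_intros)
  have "sigma_definable (\<lambda>e F. F 1 = c (e 0) (F 0) \<and> (F 0, F 1) \<in> R)"
    by (intro sigma_definable_conj c sigma_definable_rel[OF R(1)] fun_definable)
  then show "sigma_definable (\<lambda>e F. (F 0, F 1) \<in> {(x, y). y = c (e 0) x \<and> (x, y) \<in> R})" by simp
  have "sigma_definable (\<lambda>e F. (F 0, F 1) \<in> - R \<or> (\<exists>y. y = c (e 0) (F 0) \<and> \<not> y = F 1))"
    by (intro sigma_definable_disj sigma_definable_rel[OF R(2)] sigma_definable_ex_fun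
        sigma_definable_conj sigma_definable_family_app[OF c]
        sigma_definable_arith[OF arithmetical_not[OF arithmetical_fun_eq]] fun_definable tm_definable_var)
  then show "sigma_definable (\<lambda>e F. (F 0, F 1) \<notin> {(x, y). y = c (e 0) x \<and> (x, y) \<in> R})"
  proof (rule sigma_definable_cong)
    show "(F 0, F 1) \<in> - R \<or> (\<exists>y. y = c (e 0) (F 0) \<and> \<not> y = F 1) \<longleftrightarrow>
    (F 0, F 1) \<notin> {(x, y). y = c (e 0) x \<and> (x, y) \<in> R}" for e :: "nat \<Rightarrow> nat" and F :: "nat \<Rightarrow> baire"
      by auto
  qed
qed

text \<open>With \<open>f = c\<^sub>n\<close> and \<open>g = c\<^sub>m\<close>, the partial injection sends \<open>x\<close> to \<open>f x\<close> when \<open>g (f x) = x\<close>. The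
  condition on the \<open>k\<close>-th value separates its domain from its range, so that it extends to an
  involution.\<close>

definition swap :: "(baire \<times> baire) set \<Rightarrow> (baire \<Rightarrow> baire) \<Rightarrow> (baire \<Rightarrow> baire) \<Rightarrow> nat \<Rightarrow> nat \<Rightarrow> baire \<Rightarrow> baire"
  where
  "swap R f g k a x =
     (if (x, f x) \<in> R \<and> g (f x) = x \<and> x k = a \<and> \<not> f x k = a then f x
      else if (x, g x) \<in> R \<and> f (g x) = x \<and> g x k = a \<and> \<not> x k = a then g x
      else x)"

text \<open>Negations are pushed onto \<open>- R\<close> and onto equations, because Sigma^1_1
  predicates are not closed under negation.\<close>

lemma swap_iff:
  "y = swap R f g k a x \<longleftrightarrow>
    (((x, f x) \<in> R \<and> g (f x) = x \<and> (x k = a \<and> \<not> f x k = a) \<and> y = f x) \<or>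
     ((x, f x) \<in> - R \<or> \<not> g (f x) = x \<or> \<not> (x k = a \<and> \<not> f x k = a)) \<and>
     (((x, g x) \<in> R \<and> f (g x) = x \<and> (g x k = a \<and> \<not> x k = a) \<and> y = g x) \<or>
      ((x, g x) \<in> - R \<or> \<not> f (g x) = x \<or> \<not> (g x k = a \<and> \<not> x k = a)) \<and> y = x))"
proof -
  have "y = (if A then u else if B then v else x) \<longleftrightarrow>
      (A \<and> y = u) \<or> \<not> A \<and> ((B \<and> y = v) \<or> \<not> B \<and> y = x)" for A B and u v :: baire
    by simp
  then show ?thesis unfolding swap_def
    by (simp only: Compl_iff de_Morgan_conj conj_assoc not_not)
qed

text \<open>The first clause moves only points whose \<open>k\<close>-th value is \<open>a\<close>,
  the second only other points, and each lands on the opposite side, where the other clause leads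
  back.\<close>

lemma swap_involution:
  assumes "sym R"
  shows "swap R f g k a (swap R f g k a x) = x"
proof -
  let ?A = "(x, f x) \<in> R \<and> g (f x) = x \<and> x k = a \<and> \<not> f x k = a"
  let ?B = "(x, g x) \<in> R \<and> f (g x) = x \<and> g x k = a \<and> \<not> x k = a"
  consider ?A | "\<not> ?A" ?B | "\<not> ?A" "\<not> ?B" by blast
  then show ?thesis
  proof cases
    case 1
    moreover have "(f x, x) \<in> R" using symD[OF assms] 1 by blast
    moreover have "swap R f g k a x = f x" using 1 by (simp add: swap_def)
    ultimately show ?thesis by (simp add: swap_def)
  next
    case 2
    moreover have "(g x, x) \<in> R" using symD[OF assms] 2 by blast
    moreover have "swap R f g k a x = g x" using 2 by (simp add: swap_def)
    ultimately show ?thesis by (simp add: swap_def)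
  next
    case 3
    then have "swap R f g k a x = x" unfolding swap_def by (simp only: if_False)
    then show ?thesis by simp
  qed
qed

lemma swap_in: "refl R \<Longrightarrow> (x, swap R f g k a x) \<in> R"
  by (simp add: swap_def refl_on_def)

lemma swap_eq:
  assumes "(x, y) \<in> R" and "f x = y" and "g y = x" and "x k \<noteq> y k"
  shows "swap R f g k (x k) x = y"
  using assms by (simp add: swap_def)

text \<open>The chosen value exceeds both \<open>x 0\<close> and \<open>f x 0\<close>, so neither
  clause applies; this covers the diagonal of \<open>R\<close>.\<close>

lemma swap_id: "swap R f f 0 (Suc (x 0 + f x 0)) x = x"
  by (simp add: swap_def)

lemma sigma_definable_swap:
  fixes c :: "nat \<Rightarrow> baire \<Rightarrow> baire"
  assumes c: "sigma_definable (\<lambda>e F. F 1 = c (e 0) (F 0))"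
    and R: "sigma11 0 2 (rel_points R)" "sigma11 0 2 (rel_points (- R))"
  shows "sigma_definable (\<lambda>e F. F 1 = swap R (c (e 0)) (c (e 1)) (e 2) (e 3) (F 0))"
proof -
  have fun_definable: "fun_definable (\<lambda>e F. F j)" for j by (intro definable_intros)
  \<comment> \<open>\<open>u\<close>, \<open>v\<close>, \<open>u'\<close>, \<open>v'\<close> stand
    for \<open>f x\<close>, \<open>g x\<close>, \<open>g (f x)\<close>, \<open>f (g x)\<close>; once
    they are named existentially, only \<open>R\<close>, \<open>- R\<close> and arithmetic
    remain.\<close>
  let ?body = "\<lambda>(e :: nat \<Rightarrow> nat) (F :: nat \<Rightarrow> baire) u v u' v'.
    (((F 0, u) \<in> R \<and> u' = F 0 \<and> (F 0 (e 2) = e 3 \<and> \<not> u (e 2) = e 3) \<and> F 1 = u) \<or>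
     ((F 0, u) \<in> - R \<or> \<not> u' = F 0 \<or> \<not> (F 0 (e 2) = e 3 \<and> \<not> u (e 2) = e 3)) \<and>
     (((F 0, v) \<in> R \<and> v' = F 0 \<and> (v (e 2) = e 3 \<and> \<not> F 0 (e 2) = e 3) \<and> F 1 = v) \<or>
      ((F 0, v) \<in> - R \<or> \<not> v' = F 0 \<or> \<not> (v (e 2) = e 3 \<and> \<not> F 0 (e 2) = e 3)) \<and> F 1 = F 0))"
  have "sigma_definable (\<lambda>e F. \<exists>u. u = c (e 0) (F 0) \<and> (\<exists>v. v = c (e 1) (F 0) \<and>
      (\<exists>u'. u' = c (e 1) u \<and> (\<exists>v'. v' = c (e 0) v \<and> ?body e F u v u' v'))))"
    by (intro sigma_definable_ex_fun sigma_definable_conj sigma_definable_disj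
        sigma_definable_family_app[OF c] sigma_definable_rel[OF R(1)] sigma_definable_rel[OF R(2)]
        fun_definable tm_definable_var; intro sigma_definable_arith arithmetical_conj arithmetical_not arithmetical_fun_eq arithmetical_eq fun_definable tm_definable_var tm_definable_app)
  then show ?thesis
    by (rule sigma_definable_cong) (unfold swap_iff, simp only: simp_thms)
qed

definition quad :: "nat \<Rightarrow> nat \<Rightarrow> nat \<Rightarrow> nat \<Rightarrow> nat" where
  "quad n m k a = prod_encode (n, prod_encode (m, prod_encode (k, a)))"

lemma quad_cases: obtains n m k a where "i = quad n m k a"
  unfolding quad_def by (metis prod_decode_inverse surj_pair)

lemma sigma_definable_uncurry:
  assumes h: "sigma_definable (\<lambda>e F. F 1 = h (e 0) (e 1) (e 2) (e 3) (F 0))"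
    and H: "\<And>n m k a. H (quad n m k a) = h n m k a"
  shows "sigma_definable (\<lambda>e F. F 1 = H (e 0) (F 0))"
proof -
  have fun_definable: "fun_definable (\<lambda>e F. F j)" for j by (intro definable_intros)
  \<comment> \<open>The innermost quantified number becomes variable 0, so the four indices appear
    in reverse order.\<close>
  have inner: "sigma_definable (\<lambda>e F. F 1 = h (e 3) (e 2) (e 1) (e 0) (F 0))"
    using sigma_definable_subst[OF h, where \<theta> = "\<lambda>e F. F" and
        \<eta> = "\<lambda>e F. case_nat (e 3) (case_nat (e 2) (case_nat (e 1) (\<lambda>_. e 0)))"]
    by (simp add: fun_definable definable_intros numeral_2_eq_2 numeral_3_eq_3)
  have "sigma_definable (\<lambda>e F. \<exists>n m k a. quad n m k a = e 0 \<and> F 1 = h n m k a (F 0))"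
    unfolding quad_def
  proof (intro sigma_definable_ex_num, rule sigma_definable_conj)
    show "sigma_definable (\<lambda>e F. F 1 = h (e (Suc (Suc (Suc 0)))) (e (Suc (Suc 0))) (e (Suc 0)) (e 0) (F 0))"
      using inner by (simp add: numeral_2_eq_2 numeral_3_eq_3)
  qed (intro sigma_definable_arith num_definable_eq num_definable_prod_encode; intro
      num_definable_tmd tm_definable_var)
  moreover have "(\<exists>n m k a. quad n m k a = i \<and> y = h n m k a x) \<longleftrightarrow> y = H i x" for i x y
    by (rule quad_cases[of i]) (auto simp: H[symmetric])
  ultimately show ?thesis by simp
qed

theorem theorem4p1:
  fixes R :: "(baire \<times> baire) set"
  assumes "delta11_rel R"
    and "\<And>x. countable {y. (x, y) \<in> R}"
  shows "(\<exists>f :: nat \<Rightarrow> (baire \<rightharpoonup> baire).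
            delta11_rel_sequence (\<lambda>i. Map.graph (f i)) \<and>
            R = (\<Union>i. Map.graph (f i))) \<and>
         (equiv UNIV R \<longrightarrow>
           (\<exists>f :: nat \<Rightarrow> (baire \<Rightarrow> baire).
              (\<forall>i. f i \<circ> f i = id) \<and>
              delta11_rel_sequence (\<lambda>i. {(x, y). y = f i x}) \<and>
              R = (\<Union>i. {(x, y). y = f i x})))"
proof (intro conjI impI)
  have R: "sigma11 0 2 (rel_points R)" "sigma11 0 2 (rel_points (- R))"
    using assms(1) unfolding delta11_rel_def delta11_def rel_points_Compl by auto
  obtain c :: "nat \<Rightarrow> baire \<Rightarrow> baire" where c: "sigma_definable (\<lambda>e F. F 1 = c (e 0) (F 0))"
    and cover: "\<And>x y. (x, y) \<in> R \<Longrightarrow> \<exists>i. y = c i x"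
    by (rule selector_family[OF R(1) assms(2)]) blast
  show "\<exists>f :: nat \<Rightarrow> (baire \<rightharpoonup> baire).
      delta11_rel_sequence (\<lambda>i. Map.graph (f i)) \<and> R = (\<Union>i. Map.graph (f i))"
  proof (intro exI conjI)
    let ?f = "\<lambda>i x. if (x, c i x) \<in> R then Some (c i x) else None"
    have graph: "Map.graph (?f i) = {(x, y). y = c i x \<and> (x, y) \<in> R}" for i
      by (auto simp: Map.graph_def split: if_splits)
    show "delta11_rel_sequence (\<lambda>i. Map.graph (?f i))"
      unfolding graph by (rule delta11_rel_sequence_graph[OF c R])
    show "R = (\<Union>i. Map.graph (?f i))"
      unfolding graph using cover by auto
  qed
  assume "equiv UNIV R"
  then have refl: "refl R" and sym: "sym R" by (auto simp: equiv_def)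
  define f where "f i = (case prod_decode i of (n, j) \<Rightarrow> case prod_decode j of (m, l) \<Rightarrow>
    case prod_decode l of (k, a) \<Rightarrow> swap R (c n) (c m) k a)" for i
  have f: "f (quad n m k a) = swap R (c n) (c m) k a" for n m k a
    by (simp add: f_def quad_def)
  show "\<exists>f :: nat \<Rightarrow> (baire \<Rightarrow> baire). (\<forall>i. f i \<circ> f i = id) \<and>
      delta11_rel_sequence (\<lambda>i. {(x, y). y = f i x}) \<and> R = (\<Union>i. {(x, y). y = f i x})"
  proof (intro exI[of _ f] conjI allI)
    show "f i \<circ> f i = id" for i
      by (rule quad_cases[of i]) (simp add: f fun_eq_iff swap_involution[OF sym])
    show "delta11_rel_sequence (\<lambda>i. {(x, y). y = f i x})"
      by (rule delta11_rel_sequence_total) (rule sigma_definable_uncurry[OF sigma_definable_swap[OF c R] f])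
    show "R = (\<Union>i. {(x, y). y = f i x})"
    proof (intro equalityI subsetI)
      fix z
      assume "z \<in> R"
      then obtain x y where z: "z = (x, y)" "(x, y) \<in> R" by (cases z) auto
      have "\<exists>i. y = f i x"
      proof (cases "x = y")
        case True
        have "f (quad 0 0 0 (Suc (x 0 + c 0 x 0))) x = x" unfolding f by (rule swap_id)
        then show ?thesis using True by metis
      next
        case False
        then obtain k where k: "x k \<noteq> y k" by auto
        obtain n where n: "y = c n x" using cover z(2) by blast
        obtain m where m: "x = c m y" using cover symD[OF sym z(2)] by blast
        \<comment> \<open>Taking \<open>a\<close> to be \<open>x k\<close> puts \<open>x\<close> on
          the domain side and \<open>y\<close> on the range side.\<close>
        have "f (quad n m k (x k)) x = y"
          unfolding f by (rule swap_eq[of x y R "c n" "c m" k, OF z(2) n[symmetric] m[symmetric] k])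
        then show ?thesis by blast
      qed
      then show "z \<in> (\<Union>i. {(x, y). y = f i x})" using z by simp
    next
      fix z
      assume "z \<in> (\<Union>i. {(x, y). y = f i x})"
      then obtain i x where z: "z = (x, f i x)" by auto
      show "z \<in> R"
        unfolding z by (rule quad_cases[of i]) (simp add: f swap_in[OF refl])
    qed
  qed
qed

end
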